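(* Let $n\ge 1$, a setpoint $y^*\in\mathbb{R}$, a constant $\underline{b}>0$, and increasing functions $\tau_1,\tau_2:[0,\infty)\to[0,\infty)$ with $\limsup_{\rho\to 0}\tau_2(\rho)/\rho<\infty$ be given (known). Then for every $R>0$ there exists an open unbounded set (an $(n+1)$-dimensional unbounded parameter manifold) $\Omega(R)\subset\mathbb{R}^{n+1}$, depending only on these data and $R$, such that the following holds for every system $\dot x=f(x)+g(x)u$, $y=h(x)$ on $\mathbb{R}^n$ satisfying Assumptions (A), (B) and (C): whenever $(k_0,\dots,k_n)\in\Omega(R)$, for every initial state $x(0)$ with $\|x(0)\|\le R$, the solution of the closed-loop system formed with the extended PID controller $$u(t)=k_1e(t)+k_0\int_0^te(s)\,ds+k_2\dot e(t)+\cdots+k_ne^{(n-1)}(t),\qquad e(t)=y^*-y(t),$$ exists on $[0,\infty)$ and the regulation error $e(t)$ converges to zero exponentially. Moreover, if Assumption (C) is replaced by Assumption (C'), then for every $R>0$ there exists an open unbounded set (an $(n+1)$-dimensional unbounded parameter manifold) $\Omega(R)\subset\mathbb{R}^{n+1}$, depending only on $n,y^*,\underline{b},\tau_1,\tau_2$ and $R$, such that for every system $\dot x=f(x)+g(x)u$, $y=h(x)$ on $\mathbb{R}^n$ satisfying Assumptions (A), (B) and (C'), whenever $(k_0,\dots,k_n)\in\Omega(R)$, for every initial state $x(0)$ with $\|x(0)\|\le R$, the solution of the closed-loop system formed with the extended PID controller $u(t)=k_1e(t)+k_0\int_0^te(s)\,ds+k_2\dot e(t)+\cdots+k_ne^{(n-1)}(t)$,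 $e(t)=y^*-y(t)$, exists on $[0,\infty)$ and the regulation error $e(t)$ converges to zero exponentially, and in addition there exists $x^*\in\mathbb{R}^n$, depending only on $y^*$ and $\Phi$, such that the state $x(t)$ is bounded and $\lim_{t\to\infty}x(t)=x^*$.
   Context: $\|\cdot\|$ is the Euclidean norm on vectors and the induced operator norm on matrices. The system is the single-input single-output affine nonlinear system $\dot x=f(x)+g(x)u$, $y=h(x)$, where $f,g:\mathbb{R}^n\to\mathbb{R}^n$ are smooth vector fields and $h:\mathbb{R}^n\to\mathbb{R}$ is a smooth function, all unknown. Lie derivatives: $L_f h=\sum_i \frac{\partial h}{\partial x_i}f_i$, $L_f^0h=h$, $L_f^kh=L_f(L_f^{k-1}h)$, $L_gL_f^kh=\sum_i\frac{\partial L_f^kh}{\partial x_i}g_i$. Define $$\Phi(x)=(h(x),L_fh(x),\dots,L_f^{n-1}h(x))^T,\quad F(x)=L_f^nh(x),\quad G(x)=L_gL_f^{n-1}h(x),\quad H(x)=(F(x),G(x)),$$ and $z^*=(y^*,0,\dots,0)^T\in\mathbb{R}^n$, $\Phi^{-1}(z)=\{x\in\mathbb{R}^n:\Phi(x)=z\}$. $J_\Phi(x)$ denotes the Jacobian matrix of $\Phi$ and $J_\Phi^{-1}(x)$ its matrix inverse. Assumption (A): the system has uniform relative degree $n$, i.e. $L_gL_f^ih(x)=0$ for $0\le i\le n-2$ and $G(x)\ne0$ for all $x\in\mathbb{R}^n$; moreover $G(x)\ge\underline{b}>0$ for all $x\in\mathbb{R}^n$. Assumption (B): (i) $\|\Phi(x)\|\le\tau_1(\|x\|)$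 and $\|H(x)\|\le\tau_1(\|\Phi(x)\|)$ for all $x\in\mathbb{R}^n$; (ii) there exists $x^*\in\Phi^{-1}(z^* )$ such that $\|H(x)-H(x^* )\|\le\tau_2(\|\Phi(x)-\Phi(x^* )\|)$ for all $x\in\mathbb{R}^n$. Assumption (C): there are constants $N_1>0$, $N_2>0$ (possibly unknown) such that $\|J_\Phi^{-1}(x)\|\le N_1\|x\|\log\|x\|+N_2$ for all $x\in\mathbb{R}^n$ (with $0\log 0=0$). Assumption (C'): $\Phi$ is a global diffeomorphism of $\mathbb{R}^n$, i.e. a bijection with $\Phi$ and its inverse continuously differentiable. Closed loop: under (A), along solutions $y^{(j)}=L_f^jh(x)$ for $0\le j\le n-1$, so the controller is $u=k_0x_0+k_1(y^*-h(x))-\sum_{j=2}^nk_jL_f^{j-1}h(x)$ with $\dot x_0=y^*-h(x)$, $x_0(0)=0$. "$e(t)$ converges to zero exponentially" means there are $C,\alpha>0$ with $|e(t)|\le Ce^{-\alpha t}$ for all $t\ge0$. *)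

theory Defs
  imports "HOL-Analysis.Analysis"
begin

text \<open>
  The state space is \<open>real ^ 'n\<close> (here \<open>'n vect\<close>), so that \<open>n = CARD('n)\<close>. The coordinates are numbered
  \<open>0, \<dots>, n - 1\<close> along the linear order of the index type; every numeral type carries such an
  order, so every \<open>n \<ge> 1\<close> is covered.
\<close>

type_synonym 'n vect = "(real, 'n) vec"

definition pos :: "'n::{finite,linorder} \<Rightarrow> nat" where
  "pos i = card {j. j < i}"

definition coord :: "nat \<Rightarrow> 'n::{finite,linorder}" where
  "coord m = (THE i. pos i = m)"

primrec Ck :: "nat \<Rightarrow> ('a::euclidean_space \<Rightarrow> 'b::euclidean_space) \<Rightarrow> bool" where
  "Ck 0 \<phi> \<longleftrightarrow> continuous_on UNIV \<phi>"
| "Ck (Suc k) \<phi> \<longleftrightarrow>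
     (\<forall>x. \<phi> differentiable (at x)) \<and> (\<forall>v. Ck k (\<lambda>x. frechet_derivative \<phi> (at x) v))"

definition smooth :: "('a::euclidean_space \<Rightarrow> 'b::euclidean_space) \<Rightarrow> bool" where
  "smooth \<phi> \<longleftrightarrow> (\<forall>k. Ck k \<phi>)"

definition partial_deriv :: "'n::finite \<Rightarrow> ('n vect \<Rightarrow> real) \<Rightarrow> 'n vect \<Rightarrow> real" where
  "partial_deriv i \<phi> x = deriv (\<lambda>t. \<phi> (x + t *\<^sub>R axis i 1)) 0"

definition lie_deriv ::
  "(('n::finite) vect \<Rightarrow> 'n vect) \<Rightarrow> ('n vect \<Rightarrow> real) \<Rightarrow> 'n vect \<Rightarrow> real" where
  "lie_deriv f \<phi> x = (\<Sum>i\<in>UNIV. partial_deriv i \<phi> x * f x $ i)"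

definition lie_iter ::
  "(('n::finite) vect \<Rightarrow> 'n vect) \<Rightarrow> nat \<Rightarrow> ('n vect \<Rightarrow> real) \<Rightarrow> 'n vect \<Rightarrow> real" where
  "lie_iter f k h = (lie_deriv f ^^ k) h"

definition Phi ::
  "(('n::{finite,linorder}) vect \<Rightarrow> 'n vect) \<Rightarrow> ('n vect \<Rightarrow> real) \<Rightarrow> 'n vect \<Rightarrow> 'n vect" where
  "Phi f h x = (\<chi> i. lie_iter f (pos i) h x)"

definition drift ::
  "(('n::finite) vect \<Rightarrow> 'n vect) \<Rightarrow> ('n vect \<Rightarrow> real) \<Rightarrow> 'n vect \<Rightarrow> real" where
  "drift f h x = lie_iter f CARD('n) h x"

definition input_gain ::
  "(('n::finite) vect \<Rightarrow> 'n vect) \<Rightarrow> ('n vect \<Rightarrow> 'n vect) \<Rightarrow> ('n vect \<Rightarrow> real)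
    \<Rightarrow> 'n vect \<Rightarrow> real" where
  "input_gain f g h x = lie_deriv g (lie_iter f (CARD('n) - 1) h) x"

text \<open>The product norm on \<open>real \<times> real\<close> is the Euclidean one.\<close>

definition FG ::
  "(('n::finite) vect \<Rightarrow> 'n vect) \<Rightarrow> ('n vect \<Rightarrow> 'n vect) \<Rightarrow> ('n vect \<Rightarrow> real)
    \<Rightarrow> 'n vect \<Rightarrow> real \<times> real" where
  "FG f g h x = (drift f h x, input_gain f g h x)"

definition zstar :: "real \<Rightarrow> ('n::{finite,linorder}) vect" where
  "zstar ystar = (\<chi> i. if pos i = 0 then ystar else 0)"

definition uniform_relative_degree ::
  "real \<Rightarrow> (('n::finite) vect \<Rightarrow> 'n vect) \<Rightarrow> ('n vect \<Rightarrow> 'n vect) \<Rightarrow> ('n vect \<Rightarrow> real)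
    \<Rightarrow> bool" where
  "uniform_relative_degree b f g h \<longleftrightarrow>
     (\<forall>x. (\<forall>i. i + 2 \<le> CARD('n) \<longrightarrow> lie_deriv g (lie_iter f i h) x = 0) \<and>
          input_gain f g h x \<noteq> 0) \<and>
     (\<forall>x. b \<le> input_gain f g h x)"

definition growth_bounds ::
  "real \<Rightarrow> (real \<Rightarrow> real) \<Rightarrow> (real \<Rightarrow> real) \<Rightarrow> (('n::{finite,linorder}) vect \<Rightarrow> 'n vect)
    \<Rightarrow> ('n vect \<Rightarrow> 'n vect) \<Rightarrow> ('n vect \<Rightarrow> real) \<Rightarrow> bool" where
  "growth_bounds ystar \<tau>1 \<tau>2 f g h \<longleftrightarrow>
     (\<forall>x. norm (Phi f h x) \<le> \<tau>1 (norm x) \<and> norm (FG f g h x) \<le> \<tau>1 (norm (Phi f h x))) \<and>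
     (\<exists>xs. Phi f h xs = zstar ystar \<and>
        (\<forall>x. norm (FG f g h x - FG f g h xs) \<le> \<tau>2 (norm (Phi f h x - Phi f h xs))))"

text \<open>
  Uniform relative degree \<open>n\<close> makes the Jacobian of \<^term>\<open>Phi f h\<close> invertible everywhere, so below
  \<^const>\<open>matrix_inv\<close> is a genuine inverse. Since \<open>ln 0 = 0\<close>, the bound at \<open>x = 0\<close> is \<open>N2\<close>.
\<close>

definition jacobian_inverse_bound ::
  "(('n::{finite,linorder}) vect \<Rightarrow> 'n vect) \<Rightarrow> ('n vect \<Rightarrow> real) \<Rightarrow> bool" where
  "jacobian_inverse_bound f h \<longleftrightarrow>
     (\<exists>N1>0. \<exists>N2>0. \<forall>x.
        onorm ((*v) (matrix_inv (jacobian (Phi f h) (at x)))) \<le> N1 * norm x * ln (norm x) + N2)"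

definition global_C1_diffeo :: "('a::euclidean_space \<Rightarrow> 'a) \<Rightarrow> bool" where
  "global_C1_diffeo \<phi> \<longleftrightarrow> bij \<phi> \<and> Ck 1 \<phi> \<and> Ck 1 (inv \<phi>)"

text \<open>
  A gain vector \<open>(k\<^sub>0, \<dots>, k\<^sub>n)\<close> is a point of \<open>real \<times> 'n vect\<close>, with \<open>k\<^sub>0\<close> the first component
  and \<open>k\<^sub>1, \<dots>, k\<^sub>n\<close> the coordinates of the second one.
\<close>

definition gain :: "real \<times> ('n::{finite,linorder}) vect \<Rightarrow> nat \<Rightarrow> real" where
  "gain k j = (case j of 0 \<Rightarrow> fst k | Suc m \<Rightarrow> snd k $ coord m)"

text \<open>
  Along solutions \<open>y\<^sup>(\<^sup>j\<^sup>)\<close> is \<open>lie_iter f j h x\<close> for \<open>j \<le> n - 1\<close>, and \<open>q\<close> is the integral of the error.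
\<close>

definition pid_control ::
  "real \<Rightarrow> (('n::{finite,linorder}) vect \<Rightarrow> 'n vect) \<Rightarrow> ('n vect \<Rightarrow> real)
    \<Rightarrow> real \<times> 'n vect \<Rightarrow> real \<Rightarrow> 'n vect \<Rightarrow> real" where
  "pid_control ystar f h k q x =
     gain k 0 * q + gain k 1 * (ystar - h x)
       - (\<Sum>j=2..CARD('n). gain k j * lie_iter f (j - 1) h x)"

definition closed_loop_solution ::
  "real \<Rightarrow> (('n::{finite,linorder}) vect \<Rightarrow> 'n vect) \<Rightarrow> ('n vect \<Rightarrow> 'n vect)
    \<Rightarrow> ('n vect \<Rightarrow> real) \<Rightarrow> real \<times> 'n vect \<Rightarrow> 'n vect
    \<Rightarrow> (real \<Rightarrow> 'n vect) \<Rightarrow> (real \<Rightarrow> real) \<Rightarrow> bool" where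
  "closed_loop_solution ystar f g h k xi x q \<longleftrightarrow>
     x 0 = xi \<and> q 0 = 0 \<and>
     (\<forall>t\<ge>0.
        (x has_vector_derivative
           (f (x t) + pid_control ystar f h k (q t) (x t) *\<^sub>R g (x t))) (at t within {0..}) \<and>
        (q has_real_derivative (ystar - h (x t))) (at t within {0..}))"

definition converges_to_zero_exponentially :: "(real \<Rightarrow> real) \<Rightarrow> bool" where
  "converges_to_zero_exponentially e \<longleftrightarrow>
     (\<exists>C>0. \<exists>\<alpha>>0. \<forall>t\<ge>0. \<bar>e t\<bar> \<le> C * exp (- \<alpha> * t))"

text \<open>Only the values on \<open>[0,\<infinity>)\<close> of \<open>\<tau>1\<close> and \<open>\<tau>2\<close> matter; increasing is meant weakly.\<close>

definition admissible_data :: "real \<Rightarrow> (real \<Rightarrow> real) \<Rightarrow> (real \<Rightarrow> real) \<Rightarrow> bool" where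
  "admissible_data b \<tau>1 \<tau>2 \<longleftrightarrow>
     b > 0 \<and>
     mono_on {0..} \<tau>1 \<and> (\<forall>r\<ge>0. \<tau>1 r \<ge> 0) \<and>
     mono_on {0..} \<tau>2 \<and> (\<forall>r\<ge>0. \<tau>2 r \<ge> 0) \<and>
     Limsup (at_right 0) (\<lambda>r. ereal (\<tau>2 r / r)) < \<infinity>"

end

theory Submission
  imports Defs
begin

text \<open>
  Put \<open>n = CARD('n)\<close>, \<open>z = \<Phi>(x)\<close> and let \<open>x*\<close> be the equilibrium state from the growth bounds. Along
  solutions \<open>z\<close> is a chain of integrators whose last component has derivative \<open>F(x) + G(x) u\<close>. The
  integral term can supply the constant input that holds the system at \<open>x*\<close>, namely when \<open>q\<close> has the
  value \<open>q*\<close> with \<open>k\<^sub>0 q* = - F(x*) / G(x*)\<close>. In the errors \<open>\<zeta>\<^sub>0 = q* - q\<close>, \<open>\<zeta>\<^sub>1 = y - y*\<close>,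
  \<open>\<zeta>\<^sub>j = y\<^sup>(\<^sup>j\<^sup>-\<^sup>1\<^sup>)\<close> (\<open>chain_error\<close> below) the closed loop is the perturbed chain
    \<open>\<zeta>\<^sub>i' = \<zeta>\<^sub>i\<^sub>+\<^sub>1\<close> for \<open>i < n\<close>,   \<open>\<zeta>\<^sub>n' = \<Delta> - G \<Sum>\<^sub>j k\<^sub>j \<zeta>\<^sub>j\<close>,
  where \<open>\<Delta>\<close> is the deviation of \<open>F - G F(x*) / G(x*)\<close> from its zero value at \<open>x*\<close>. By the second
  growth bound \<open>\<bar>\<Delta>\<bar> \<le> L \<bar>\<zeta>\<bar>\<close> on every ball, with \<open>L\<close> depending only on the ball and the known data.

  If \<open>k\<^sub>j\<close> is within distance 1 of \<open>k\<^sub>n\<close> times the coefficient of \<open>s\<^sup>j\<close> in \<open>(s + 2)\<^sup>n\<close>, then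
  \<open>\<Sum>\<^sub>j k\<^sub>j \<zeta>\<^sub>j\<close> differs from \<open>k\<^sub>n \<eta>\<^sub>n\<close> by a combination of the \<open>\<zeta>\<^sub>j\<close> with coefficients at most 1, where
  \<open>\<eta>\<^sub>j = (d/dt + 2)\<^sup>j \<zeta>\<^sub>0\<close>. These filtered errors satisfy \<open>\<eta>\<^sub>j' = - 2 \<eta>\<^sub>j + \<eta>\<^sub>j\<^sub>+\<^sub>1\<close> for \<open>j < n\<close>, so
  \<open>V = \<Sum>\<^sub>j \<eta>\<^sub>j\<^sup>2\<close> obeys \<open>V' \<le> - V\<close> on a prescribed sublevel set as soon as \<open>k\<^sub>n\<close> exceeds a threshold;
  the term \<open>- 2 G k\<^sub>n \<eta>\<^sub>n\<^sup>2\<close>, with \<open>G \<ge> b\<close>, dominates all the others (\<open>lyapunov_dissipation\<close>,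
  \<open>integrator_chain_decay\<close>). The sublevel set is chosen to contain all initial errors, whose size is
  controlled by \<open>R\<close> and the known data since \<open>k\<^sub>0 \<ge> 1\<close>. These inequalities on the gains cut out an
  open unbounded set, which depends on the known data only, and on it all \<open>\<zeta>\<^sub>i\<close> and \<open>z'\<close> decay like
  \<open>exp (- t / 2)\<close> for as long as the solution lives (\<open>chain_error_decay\<close>).

  It remains to keep \<open>x\<close> itself bounded, which also gives existence for all times. If \<open>\<Phi>\<close> is a global
  diffeomorphism, \<open>x\<close> stays in the preimage of a compact set and tends to \<open>\<Phi>\<^sup>-\<^sup>1(z*)\<close>. Under the
  growth condition on \<open>J\<^sup>-\<^sup>1\<close>, where \<open>J\<close> is the Jacobian of \<open>\<Phi>\<close>, one has \<open>x' = J\<^sup>-\<^sup>1 z'\<close>, hence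
  \<open>\<bar>x'\<bar> \<le> (N\<^sub>1 \<bar>x\<bar> log \<bar>x\<bar> + N\<^sub>2) \<bar>z'\<bar>\<close> with \<open>z'\<close> integrable over time; so \<open>log log \<bar>x\<bar>\<close> stays bounded
  (\<open>norm_bound_of_log_growth\<close>). That \<open>J\<close> is invertible at every point follows from the relative degree
  through iterated Lie brackets (\<open>invertible_jacobian_Phi\<close>).
\<close>

section \<open>Calculus of \<open>C\<^sup>k\<close> maps\<close>

lemma Ck_Suc_has_derivative:
  assumes "Ck (Suc k) \<phi>"
  shows "(\<phi> has_derivative frechet_derivative \<phi> (at x)) (at x)"
  using assms by (simp add: frechet_derivative_works)

lemma Ck_SucI:
  assumes "\<And>x. (\<phi> has_derivative D x) (at x)" and "\<And>v. Ck k (\<lambda>x. D x v)"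
  shows "Ck (Suc k) \<phi>"
proof -
  have "frechet_derivative \<phi> (at x) = D x" for x
    using frechet_derivative_at[OF assms(1)] by simp
  then show ?thesis
    using assms by (auto simp: differentiable_def)
qed

text \<open>
  The definition of \<^const>\<open>Ck\<close> asks at level \<open>k + 1\<close> only for differentiability and for the
  directional derivatives to be \<open>C\<^sup>k\<close>; continuity at the lower levels has to be recovered from
  differentiability.
\<close>

lemma Ck_Suc_imp_Ck: "Ck (Suc k) \<phi> \<Longrightarrow> Ck k \<phi>"
proof (induction k arbitrary: \<phi>)
  case 0
  then show ?case
    by (auto simp: continuous_on_eq_continuous_within differentiable_imp_continuous_within)
qed auto

lemma Ck_const: "Ck k (\<lambda>x. c)"
proof (induction k arbitrary: c)
  case (Suc k)
  show ?case by (rule Ck_SucI[where D = "\<lambda>_ _. 0"]) (auto intro: Suc)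
qed simp

lemma Ck_add: "Ck k \<phi> \<Longrightarrow> Ck k \<psi> \<Longrightarrow> Ck k (\<lambda>x. \<phi> x + \<psi> x)"
proof (induction k arbitrary: \<phi> \<psi>)
  case 0
  then show ?case by (auto intro: continuous_intros)
next
  case (Suc k)
  show ?case
    by (rule Ck_SucI[OF has_derivative_add[OF Ck_Suc_has_derivative[OF Suc.prems(1)]
          Ck_Suc_has_derivative[OF Suc.prems(2)]]])
      (use Suc in auto)
qed

lemma Ck_sum:
  assumes "\<And>i. i \<in> I \<Longrightarrow> Ck k (\<phi> i)"
  shows "Ck k (\<lambda>x. \<Sum>i\<in>I. \<phi> i x)"
  using assms by (induction I rule: infinite_finite_induct) (auto intro: Ck_const Ck_add)

lemma Ck_bilinear:
  assumes "bounded_bilinear B"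
  shows "Ck k \<phi> \<Longrightarrow> Ck k \<psi> \<Longrightarrow> Ck k (\<lambda>x. B (\<phi> x) (\<psi> x))"
proof (induction k arbitrary: \<phi> \<psi>)
  case 0
  then show ?case by (auto intro: bounded_bilinear.continuous_on[OF assms])
next
  case (Suc k)
  show ?case
  proof (rule Ck_SucI[OF bounded_bilinear.FDERIV[OF assms Ck_Suc_has_derivative[OF Suc.prems(1)]
          Ck_Suc_has_derivative[OF Suc.prems(2)]]])
    fix v
    show "Ck k (\<lambda>x. B (\<phi> x) (frechet_derivative \<psi> (at x) v) + B (frechet_derivative \<phi> (at x) v) (\<psi> x))"
      using Suc.prems Suc.prems[THEN Ck_Suc_imp_Ck] by (intro Ck_add Suc.IH) auto
  qed
qed

lemma Ck_linear_comp:
  assumes L: "bounded_linear L"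
  shows "Ck k \<phi> \<Longrightarrow> Ck k (\<lambda>x. L (\<phi> x))"
proof (induction k arbitrary: \<phi>)
  case 0
  then show ?case by (auto intro: bounded_linear.continuous_on[OF L])
next
  case (Suc k)
  show ?case
    by (rule Ck_SucI[OF bounded_linear.has_derivative[OF L Ck_Suc_has_derivative[OF Suc.prems]]])
      (use Suc in auto)
qed

lemma Ck_comp_linear:
  assumes L: "bounded_linear L"
  shows "Ck k \<phi> \<Longrightarrow> Ck k (\<lambda>x. \<phi> (L x))"
proof (induction k arbitrary: \<phi>)
  case 0
  then show ?case
    using continuous_on_compose2[of UNIV \<phi> UNIV L] bounded_linear.continuous_on[OF L, of UNIV "\<lambda>x. x"]
    by auto
next
  case (Suc k)
  have "((\<lambda>x. \<phi> (L x)) has_derivative (\<lambda>v. frechet_derivative \<phi> (at (L x)) (L v))) (at x)" for x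
    using has_derivative_compose[OF bounded_linear_imp_has_derivative[OF L] Ck_Suc_has_derivative[OF Suc.prems]] .
  then show ?case
    by (rule Ck_SucI) (use Suc in auto)
qed

lemmas Ck_scaleR = Ck_bilinear[OF bounded_bilinear_scaleR]
  and Ck_mult = Ck_bilinear[OF bounded_bilinear_mult]

lemma Ck_ident: "Ck k (\<lambda>x. x)"
  by (cases k) (auto intro!: Ck_SucI[where D = "\<lambda>_ v. v"] Ck_const)

lemma Ck_diff: "Ck k \<phi> \<Longrightarrow> Ck k \<psi> \<Longrightarrow> Ck k (\<lambda>x. \<phi> x - \<psi> x)"
  using Ck_add[of k \<phi> "\<lambda>x. - \<psi> x"] Ck_linear_comp[OF bounded_linear_minus[OF bounded_linear_ident], of k \<psi>]
  by simp

lemma Ck_Pair: "Ck k \<phi> \<Longrightarrow> Ck k \<psi> \<Longrightarrow> Ck k (\<lambda>x. (\<phi> x, \<psi> x))"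
  using Ck_add[OF Ck_linear_comp[OF bounded_linear_Pair[OF bounded_linear_ident bounded_linear_zero], of k \<phi>]
      Ck_linear_comp[OF bounded_linear_Pair[OF bounded_linear_zero bounded_linear_ident], of k \<psi>]]
  by simp

text \<open>
  On the compact ball the derivative is bounded in each of the finitely many basis directions, hence in
  operator norm, and a ball is convex.
\<close>

lemma Ck_1_lipschitz_on_cball:
  fixes \<phi> :: "'a::euclidean_space \<Rightarrow> 'b::euclidean_space"
  assumes "Ck 1 \<phi>"
  shows "\<exists>L. L-lipschitz_on (cball 0 r) \<phi>"
proof -
  let ?D = "\<lambda>x. frechet_derivative \<phi> (at x)"
  have der: "(\<phi> has_derivative ?D x) (at x)" for x
    using assms Ck_Suc_has_derivative[of 0] by simp
  have "\<exists>B. \<forall>x\<in>cball 0 r. norm (?D x v) \<le> B" for v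
  proof -
    have "continuous_on UNIV (\<lambda>x. ?D x v)" using assms by simp
    then have "bounded ((\<lambda>x. ?D x v) ` cball 0 r)"
      by (intro compact_imp_bounded compact_continuous_image) (auto intro: continuous_on_subset)
    then show ?thesis by (auto simp: bounded_iff)
  qed
  then obtain B where B: "\<And>v x. x \<in> cball 0 r \<Longrightarrow> norm (?D x v) \<le> B v" by metis
  define K where "K = (\<Sum>b\<in>Basis. \<bar>B b\<bar>)"
  have "onorm (?D x) \<le> K" if x: "x \<in> cball 0 r" for x
  proof (rule onorm_bound)
    show "0 \<le> K" by (simp add: K_def sum_nonneg)
    fix v :: 'a
    have "?D x v = ?D x (\<Sum>b\<in>Basis. (v \<bullet> b) *\<^sub>R b)" by (simp add: euclidean_representation)
    also have "\<dots> = (\<Sum>b\<in>Basis. (v \<bullet> b) *\<^sub>R ?D x b)"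
      using has_derivative_linear[OF der[of x]] by (simp add: linear_sum linear_cmul)
    finally have "norm (?D x v) \<le> (\<Sum>b\<in>Basis. norm ((v \<bullet> b) *\<^sub>R ?D x b))"
      using norm_sum by metis
    also have "\<dots> \<le> (\<Sum>b\<in>Basis. norm v * \<bar>B b\<bar>)"
    proof (rule sum_mono)
      fix b :: 'a assume "b \<in> Basis"
      then have "\<bar>v \<bullet> b\<bar> \<le> norm v" by (rule Basis_le_norm)
      moreover have "norm (?D x b) \<le> \<bar>B b\<bar>" using B[OF x, of b] by linarith
      ultimately show "norm ((v \<bullet> b) *\<^sub>R ?D x b) \<le> norm v * \<bar>B b\<bar>"
        by (simp add: mult_mono)
    qed
    finally show "norm (?D x v) \<le> K * norm v"
      by (simp add: K_def sum_distrib_left mult.commute)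
  qed
  note onorm_le = this
  have "norm (\<phi> x - \<phi> y) \<le> K * norm (x - y)" if "x \<in> cball 0 r" "y \<in> cball 0 r" for x y
    by (rule differentiable_bound[where S = "cball 0 r" and f' = ?D])
      (use that onorm_le in \<open>auto intro: has_derivative_at_withinI[OF der]\<close>)
  then show ?thesis
    unfolding lipschitz_on_def dist_norm
    by (intro exI[of _ K]) (auto simp: K_def sum_nonneg)
qed

text \<open>
  The second difference of \<open>\<phi>\<close> over a parallelogram is symmetric in the two sides \<open>u\<close> and \<open>v\<close>. Two
  applications of the mean value theorem, along \<open>u\<close> and then along \<open>v\<close>, turn it into a mixed second
  derivative; exchanging the sides gives the other mixed derivative at a nearby point, and continuity
  identifies the two in the limit (Schwarz's theorem below).
\<close>

lemma second_difference_mvt: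
  fixes \<phi> :: "'a::euclidean_space \<Rightarrow> real"
  assumes d: "\<And>z. (\<phi> has_derivative D z) (at z)"
    and d2: "\<And>z. ((\<lambda>z. D z u) has_derivative DD z) (at z)"
    and s: "s > 0"
  shows "\<exists>\<theta> \<theta>'. 0 < \<theta> \<and> \<theta> < s \<and> 0 < \<theta>' \<and> \<theta>' < s \<and>
     \<phi> (x + s *\<^sub>R u + s *\<^sub>R v) - \<phi> (x + s *\<^sub>R u) - \<phi> (x + s *\<^sub>R v) + \<phi> x
       = s * s * DD (x + \<theta> *\<^sub>R u + \<theta>' *\<^sub>R v) v"
proof -
  have lin: "D z (c *\<^sub>R w) = c * D z w" for z c w
    using has_derivative_linear[OF d[of z]] by (simp add: linear_cmul)
  have lin2: "DD z (c *\<^sub>R w) = c * DD z w" for z c w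
    using has_derivative_linear[OF d2[of z]] by (simp add: linear_cmul)
  have a: "((\<lambda>t. \<phi> (p + t *\<^sub>R u)) has_real_derivative D (p + t *\<^sub>R u) u) (at t)" for p t
  proof -
    have "((\<lambda>t. p + t *\<^sub>R u) has_derivative (\<lambda>r. r *\<^sub>R u)) (at t)"
      by (auto intro!: derivative_eq_intros)
    from has_derivative_compose[OF this d]
    show ?thesis by (simp add: has_field_derivative_def lin mult.commute[of _ "D _ _"])
  qed
  have b: "((\<lambda>t. D (p + t *\<^sub>R v) u) has_real_derivative DD (p + t *\<^sub>R v) v) (at t)" for p t
  proof -
    have "((\<lambda>t. p + t *\<^sub>R v) has_derivative (\<lambda>r. r *\<^sub>R v)) (at t)"
      by (auto intro!: derivative_eq_intros)
    from has_derivative_compose[OF this d2]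
    show ?thesis by (simp add: has_field_derivative_def lin2 mult.commute[of _ "DD _ _"])
  qed
  define A where "A t = \<phi> ((x + s *\<^sub>R v) + t *\<^sub>R u) - \<phi> (x + t *\<^sub>R u)" for t
  have "\<exists>\<theta>. 0 < \<theta> \<and> \<theta> < s \<and>
     A s - A 0 = (s - 0) * (D ((x + s *\<^sub>R v) + \<theta> *\<^sub>R u) u - D (x + \<theta> *\<^sub>R u) u)"
    unfolding A_def by (rule MVT2[OF s]) (rule DERIV_diff[OF a a])
  then obtain \<theta> where \<theta>: "0 < \<theta>" "\<theta> < s"
    "A s - A 0 = s * (D (x + \<theta> *\<^sub>R u + s *\<^sub>R v) u - D (x + \<theta> *\<^sub>R u) u)"
    by (auto simp: algebra_simps)
  have "\<exists>\<theta>'. 0 < \<theta>' \<and> \<theta>' < s \<and>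
     D ((x + \<theta> *\<^sub>R u) + s *\<^sub>R v) u - D ((x + \<theta> *\<^sub>R u) + 0 *\<^sub>R v) u
       = (s - 0) * DD ((x + \<theta> *\<^sub>R u) + \<theta>' *\<^sub>R v) v"
    by (rule MVT2[OF s]) (rule b)
  then obtain \<theta>' where \<theta>': "0 < \<theta>'" "\<theta>' < s"
    "D (x + \<theta> *\<^sub>R u + s *\<^sub>R v) u - D (x + \<theta> *\<^sub>R u) u = s * DD (x + \<theta> *\<^sub>R u + \<theta>' *\<^sub>R v) v"
    by auto
  have "A s - A 0 = \<phi> (x + s *\<^sub>R u + s *\<^sub>R v) - \<phi> (x + s *\<^sub>R u) - \<phi> (x + s *\<^sub>R v) + \<phi> x"
    by (simp add: A_def algebra_simps)
  with \<theta> \<theta>' show ?thesis by (intro exI[of _ \<theta>] exI[of _ \<theta>']) auto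
qed

lemma second_derivative_symmetric:
  fixes \<phi> :: "'a::euclidean_space \<Rightarrow> real"
  assumes "Ck 2 \<phi>"
  shows "frechet_derivative (\<lambda>z. frechet_derivative \<phi> (at z) u) (at x) v
       = frechet_derivative (\<lambda>z. frechet_derivative \<phi> (at z) v) (at x) u"
proof -
  define D where "D z = frechet_derivative \<phi> (at z)" for z
  define DD where "DD u z = frechet_derivative (\<lambda>z. D z u) (at z)" for u z
  have C2: "Ck (Suc (Suc 0)) \<phi>" using assms by (simp add: numeral_2_eq_2)
  have d: "(\<phi> has_derivative D z) (at z)" for z
    unfolding D_def by (rule Ck_Suc_has_derivative[OF C2])
  have d2: "((\<lambda>z. D z u) has_derivative DD u z) (at z)" for z u
    unfolding DD_def by (rule Ck_Suc_has_derivative[of 0]) (use C2 in \<open>auto simp: D_def\<close>)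
  have cont: "isCont (\<lambda>z. DD u z v) x" for u v
    using C2 by (auto simp: D_def DD_def continuous_on_eq_continuous_at)
  have "\<bar>DD u x v - DD v x u\<bar> \<le> e" if e: "e > 0" for e
  proof -
    obtain r where r: "r > 0" "\<And>z. dist z x < r \<Longrightarrow> dist (DD u z v) (DD u x v) < e / 2"
      "\<And>z. dist z x < r \<Longrightarrow> dist (DD v z u) (DD v x u) < e / 2"
    proof -
      obtain r1 where "r1 > 0" "\<And>z. dist z x < r1 \<Longrightarrow> dist (DD u z v) (DD u x v) < e / 2"
        using cont[of u v] e unfolding continuous_at_eps_delta by (metis half_gt_zero)
      moreover obtain r2 where "r2 > 0" "\<And>z. dist z x < r2 \<Longrightarrow> dist (DD v z u) (DD v x u) < e / 2"
        using cont[of v u] e unfolding continuous_at_eps_delta by (metis half_gt_zero)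
      ultimately show ?thesis by (intro that[of "min r1 r2"]) auto
    qed
    define s where "s = r / (norm u + norm v + 1)"
    have nn: "0 < norm u + norm v + 1" by (simp add: add_nonneg_pos)
    have s: "s > 0" using r(1) nn by (simp add: s_def)
    have close: "dist (x + a *\<^sub>R u + b *\<^sub>R v) x < r" if "0 < a" "a < s" "0 < b" "b < s" for a b
    proof -
      have "dist (x + a *\<^sub>R u + b *\<^sub>R v) x = norm (a *\<^sub>R u + b *\<^sub>R v)"
        by (simp add: dist_norm add.assoc)
      also have "\<dots> \<le> a * norm u + b * norm v"
        using norm_triangle_ineq[of "a *\<^sub>R u" "b *\<^sub>R v"] that by simp
      also have "\<dots> \<le> s * norm u + s * norm v"
        using that by (intro add_mono mult_right_mono) auto
      also have "\<dots> < s * (norm u + norm v + 1)" using s by (simp add: algebra_simps)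
      also have "\<dots> = r" using nn by (simp add: s_def)
      finally show ?thesis .
    qed
    obtain a b where ab: "0 < a" "a < s" "0 < b" "b < s"
      "\<phi> (x + s *\<^sub>R u + s *\<^sub>R v) - \<phi> (x + s *\<^sub>R u) - \<phi> (x + s *\<^sub>R v) + \<phi> x
       = s * s * DD u (x + a *\<^sub>R u + b *\<^sub>R v) v"
      using second_difference_mvt[OF d d2 s, of x u v] by blast
    obtain a' b' where ab': "0 < a'" "a' < s" "0 < b'" "b' < s"
      "\<phi> (x + s *\<^sub>R v + s *\<^sub>R u) - \<phi> (x + s *\<^sub>R v) - \<phi> (x + s *\<^sub>R u) + \<phi> x
       = s * s * DD v (x + a' *\<^sub>R v + b' *\<^sub>R u) u"
      using second_difference_mvt[OF d d2 s, of x v u] by blast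
    have "s * s * DD u (x + a *\<^sub>R u + b *\<^sub>R v) v = s * s * DD v (x + b' *\<^sub>R u + a' *\<^sub>R v) u"
      using ab(5) ab'(5) by (simp add: algebra_simps)
    then have "DD u (x + a *\<^sub>R u + b *\<^sub>R v) v = DD v (x + b' *\<^sub>R u + a' *\<^sub>R v) u"
      using s by simp
    then show ?thesis
      using r(2)[OF close[OF ab(1-4)]] r(3)[OF close[OF ab'(3,4,1,2)]]
      unfolding dist_real_def by linarith
  qed
  then have "\<bar>DD u x v - DD v x u\<bar> \<le> 0" using field_le_epsilon[of "\<bar>DD u x v - DD v x u\<bar>" 0] by simp
  then show ?thesis by (simp add: D_def DD_def)
qed

lemma smooth_imp_Ck: "smooth \<phi> \<Longrightarrow> Ck k \<phi>"
  by (simp add: smooth_def)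

lemma smooth_has_derivative:
  "smooth \<phi> \<Longrightarrow> (\<phi> has_derivative frechet_derivative \<phi> (at x)) (at x)"
  using Ck_Suc_has_derivative[of 0 \<phi> x] by (simp add: smooth_def del: Ck.simps)

lemma smooth_directional_derivative:
  assumes "smooth \<phi>" shows "smooth (\<lambda>x. frechet_derivative \<phi> (at x) v)"
  unfolding smooth_def
proof
  fix k
  show "Ck k (\<lambda>x. frechet_derivative \<phi> (at x) v)"
    using smooth_imp_Ck[OF assms, of "Suc k"] by simp
qed

lemma frechet_derivative_basis_expansion:
  assumes "smooth \<phi>"
  shows "frechet_derivative \<phi> (at x) w = (\<Sum>b\<in>Basis. (w \<bullet> b) *\<^sub>R frechet_derivative \<phi> (at x) b)"
proof -
  have "frechet_derivative \<phi> (at x) w = frechet_derivative \<phi> (at x) (\<Sum>b\<in>Basis. (w \<bullet> b) *\<^sub>R b)"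
    by (simp add: euclidean_representation)
  also have "\<dots> = (\<Sum>b\<in>Basis. (w \<bullet> b) *\<^sub>R frechet_derivative \<phi> (at x) b)"
    using has_derivative_linear[OF smooth_has_derivative[OF assms]] by (simp add: linear_sum linear_cmul)
  finally show ?thesis .
qed

lemma smooth_derivative_along:
  assumes "smooth \<phi>" "smooth X"
  shows "smooth (\<lambda>x. frechet_derivative \<phi> (at x) (X x))"
  unfolding smooth_def frechet_derivative_basis_expansion[OF assms(1), of _ "X _"]
  by (intro allI Ck_sum Ck_scaleR smooth_imp_Ck[OF smooth_directional_derivative] assms
      Ck_linear_comp[OF bounded_linear_inner_left] smooth_imp_Ck)

lemma smooth_diff: "smooth \<phi> \<Longrightarrow> smooth \<psi> \<Longrightarrow> smooth (\<lambda>x. \<phi> x - \<psi> x)"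
  by (simp add: smooth_def Ck_diff)

text \<open>
  Expanding the field \<open>X\<close> in the standard basis separates the two sources of variation: the point
  where the derivative of \<open>\<phi>\<close> is taken, and the direction \<open>X\<close> in which it is taken.
\<close>

lemma derivative_of_derivative_along:
  fixes \<phi> :: "'a::euclidean_space \<Rightarrow> real"
  assumes "smooth \<phi>" "smooth X"
  shows "((\<lambda>z. frechet_derivative \<phi> (at z) (X z)) has_derivative
      (\<lambda>v. frechet_derivative (\<lambda>z. frechet_derivative \<phi> (at z) (X x)) (at x) v
         + frechet_derivative \<phi> (at x) (frechet_derivative X (at x) v))) (at x)"
proof -
  let ?D = "\<lambda>z. frechet_derivative \<phi> (at z)" and ?DX = "frechet_derivative X (at x)"
  let ?DD = "\<lambda>b. frechet_derivative (\<lambda>z. ?D z b) (at x)"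
  have X: "(X has_derivative ?DX) (at x)" by (rule smooth_has_derivative[OF assms(2)])
  have DD: "((\<lambda>z. ?D z b) has_derivative ?DD b) (at x)" for b
    by (intro smooth_has_derivative smooth_directional_derivative assms)
  have "((\<lambda>z. \<Sum>b\<in>Basis. (X z \<bullet> b) *\<^sub>R ?D z b) has_derivative
     (\<lambda>v. \<Sum>b\<in>Basis. (X x \<bullet> b) *\<^sub>R ?DD b v + (?DX v \<bullet> b) *\<^sub>R ?D x b)) (at x)"
    by (intro has_derivative_sum has_derivative_scaleR has_derivative_inner_left X DD)
  moreover have "((\<lambda>z. \<Sum>b\<in>Basis. (X x \<bullet> b) *\<^sub>R ?D z b) has_derivative
     (\<lambda>v. \<Sum>b\<in>Basis. (X x \<bullet> b) *\<^sub>R ?DD b v)) (at x)"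
    by (intro has_derivative_sum has_derivative_scaleR_right DD)
  then have "?DD (X x) = (\<lambda>v. \<Sum>b\<in>Basis. (X x \<bullet> b) *\<^sub>R ?DD b v)"
    unfolding frechet_derivative_basis_expansion[OF assms(1), of _ "X x", symmetric]
    by (rule frechet_derivative_at[symmetric])
  ultimately show ?thesis
    unfolding frechet_derivative_basis_expansion[OF assms(1), of _ "X _", symmetric]
    by (simp add: sum.distrib frechet_derivative_basis_expansion[OF assms(1), of _ "?DX _"])
qed

section \<open>Lie derivatives and Lie brackets\<close>

lemma lie_deriv_eq_derivative:
  assumes "smooth \<phi>"
  shows "lie_deriv f \<phi> x = frechet_derivative \<phi> (at x) (f x)"
proof -
  let ?D = "frechet_derivative \<phi> (at x)"
  have lin: "linear ?D" by (rule has_derivative_linear[OF smooth_has_derivative[OF assms]])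
  have "partial_deriv i \<phi> x = ?D (axis i 1)" for i
  proof -
    have 1: "((\<lambda>t. x + t *\<^sub>R axis i 1) has_derivative (\<lambda>r. r *\<^sub>R axis i 1)) (at (0::real))"
      by (auto intro!: derivative_eq_intros)
    have 2: "(\<phi> has_derivative ?D) (at (x + 0 *\<^sub>R axis i 1))"
      using smooth_has_derivative[OF assms] by simp
    have "((\<lambda>t. \<phi> (x + t *\<^sub>R axis i 1)) has_derivative (\<lambda>r. ?D (r *\<^sub>R axis i 1))) (at 0)"
      using has_derivative_compose[OF 1 2] .
    then have "((\<lambda>t. \<phi> (x + t *\<^sub>R axis i 1)) has_real_derivative ?D (axis i 1)) (at 0)"
      using lin by (simp add: has_field_derivative_def linear_cmul mult.commute[of _ "?D _"])
    then show ?thesis unfolding partial_deriv_def by (rule DERIV_imp_deriv)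
  qed
  then have "lie_deriv f \<phi> x = (\<Sum>i\<in>UNIV. f x $ i *\<^sub>R ?D (axis i 1))"
    by (simp add: lie_deriv_def mult.commute)
  also have "\<dots> = ?D (\<Sum>i\<in>UNIV. f x $ i *\<^sub>R axis i 1)"
    using lin by (simp add: linear_sum linear_cmul)
  also have "(\<Sum>i\<in>UNIV. f x $ i *\<^sub>R axis i 1) = f x"
    using basis_expansion[of "f x"] by (simp add: scalar_mult_eq_scaleR)
  finally show ?thesis .
qed

lemma lie_iter_Suc: "lie_iter f (Suc k) h = lie_deriv f (lie_iter f k h)"
  by (simp add: lie_iter_def)

lemma smooth_lie_iter:
  assumes "smooth f" "smooth h" shows "smooth (lie_iter f k h)"
proof (induction k)
  case 0
  then show ?case using assms by (simp add: lie_iter_def)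
next
  case (Suc k)
  have "lie_iter f (Suc k) h = (\<lambda>x. frechet_derivative (lie_iter f k h) (at x) (f x))"
    by (auto simp: lie_iter_Suc lie_deriv_eq_derivative[OF Suc])
  then show ?case using smooth_derivative_along[OF Suc assms(1)] by simp
qed

definition lie_bracket :: "('a::euclidean_space \<Rightarrow> 'a) \<Rightarrow> ('a \<Rightarrow> 'a) \<Rightarrow> 'a \<Rightarrow> 'a" where
  "lie_bracket f X x = frechet_derivative X (at x) (f x) - frechet_derivative f (at x) (X x)"

lemma smooth_lie_bracket: "smooth f \<Longrightarrow> smooth X \<Longrightarrow> smooth (lie_bracket f X)"
  unfolding lie_bracket_def[abs_def] by (intro smooth_diff smooth_derivative_along)

text \<open>
  In \<open>L\<^sub>f L\<^sub>X \<phi> - L\<^sub>X L\<^sub>f \<phi>\<close> the second derivatives of \<open>\<phi>\<close> cancel by symmetry, and what remains is the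
  derivative of \<open>\<phi>\<close> in the direction of the bracket.
\<close>

lemma lie_deriv_lie_bracket:
  assumes "smooth f" "smooth X" "smooth \<phi>"
  shows "lie_deriv (lie_bracket f X) \<phi> x
       = lie_deriv f (lie_deriv X \<phi>) x - lie_deriv X (lie_deriv f \<phi>) x"
proof -
  let ?D = "\<lambda>z. frechet_derivative \<phi> (at z)"
  have along: "lie_deriv Y (lie_deriv Z \<phi>) x
      = frechet_derivative (\<lambda>z. ?D z (Z x)) (at x) (Y x) + ?D x (frechet_derivative Z (at x) (Y x))"
    if Z: "smooth Z" for Y Z
  proof -
    have eq: "lie_deriv Z \<phi> = (\<lambda>z. ?D z (Z z))" by (auto simp: lie_deriv_eq_derivative assms)
    show ?thesis
      unfolding eq lie_deriv_eq_derivative[OF smooth_derivative_along[OF assms(3) Z]]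
      by (rule fun_cong[OF frechet_derivative_at[OF derivative_of_derivative_along[OF assms(3) Z], symmetric]])
  qed
  have "frechet_derivative (\<lambda>z. ?D z (X x)) (at x) (f x) = frechet_derivative (\<lambda>z. ?D z (f x)) (at x) (X x)"
    by (rule second_derivative_symmetric[OF smooth_imp_Ck[OF assms(3)]])
  moreover have "?D x (lie_bracket f X x)
     = ?D x (frechet_derivative X (at x) (f x)) - ?D x (frechet_derivative f (at x) (X x))"
    unfolding lie_bracket_def
    by (rule linear_diff[OF has_derivative_linear[OF smooth_has_derivative[OF assms(3)]]])
  ultimately show ?thesis
    by (simp add: along assms lie_deriv_eq_derivative[OF assms(3), of "lie_bracket f X"])
qed

section \<open>Global solutions of autonomous differential equations\<close>

lemma integral_has_vector_derivative_atLeast: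
  fixes F :: "real \<Rightarrow> 'a::euclidean_space"
  assumes "continuous_on {0..} F" "t \<ge> 0"
  shows "((\<lambda>p. integral {0..p} F) has_vector_derivative F t) (at t within {0..})"
proof -
  have "((\<lambda>p. integral {0..p} F) has_vector_derivative F t) (at t within {0..t+1})"
    using assms by (intro integral_has_vector_derivative) (auto intro: continuous_on_subset)
  moreover have "at t within {0..t+1} = at t within {0..}"
    by (rule at_within_nhd[of _ "{..<t+1}"]) auto
  ultimately show ?thesis by simp
qed

text \<open>
  Picard iteration on the whole half-line at once. Writing a solution as
  \<open>w\<^sub>0 + exp (c t) w(t)\<close> with \<open>c = 2 (L + 1)\<close> makes the integral operator a contraction with factor
  \<open>L / c \<le> 1 / 2\<close> in the supremum norm of \<open>w\<close>, so no gluing of local solutions is needed. Boundedness of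
  the field keeps the iterates in the space of bounded functions; times \<open>t < 0\<close> are
  collapsed to \<open>0\<close> because that space consists of functions on all reals.
\<close>

lemma lipschitz_bounded_ode_solution:
  fixes V :: "'a::euclidean_space \<Rightarrow> 'a"
  assumes lip: "L-lipschitz_on UNIV V" and bnd: "\<And>x. norm (V x) \<le> B"
  shows "\<exists>W. W 0 = w0 \<and> (\<forall>t\<ge>0. (W has_vector_derivative V (W t)) (at t within {0..}))"
proof -
  have L0: "L \<ge> 0" using lip by (rule lipschitz_on_nonneg)
  have B0: "B \<ge> 0" using bnd[of 0] norm_ge_zero order_trans by blast
  define c where "c = 2 * (L + 1)"
  have c: "c > 0" "L / c \<le> 1 / 2" using L0 by (auto simp: c_def field_simps)
  have Vcont: "continuous_on S V" for S
    using lipschitz_on_continuous_on[OF lip] continuous_on_subset by blast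
  define F where "F w s = V (w0 + exp (c * s) *\<^sub>R apply_bcontfun w s)" for w :: "real \<Rightarrow>\<^sub>C 'a" and s
  have Fcont: "continuous_on S (F w)" for S w
    unfolding F_def by (intro continuous_on_compose2[OF Vcont[of UNIV]] continuous_intros) auto
  have Fint: "F w integrable_on {0..p}" for w p
    by (rule integrable_continuous_real[OF Fcont])
  define J where "J w p = integral {0..p} (F w)" for w p
  have Jder: "(J w has_vector_derivative F w t) (at t within {0..})" if "t \<ge> 0" for w t
    unfolding J_def using that by (intro integral_has_vector_derivative_atLeast Fcont)
  have Jcont: "continuous_on {0..} (J w)" for w
    by (auto simp: continuous_on_eq_continuous_within intro!: has_vector_derivative_continuous Jder)
  have Jbnd: "norm (J w p) \<le> p * B" if "p \<ge> 0" for w p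
  proof -
    have "norm (J w p) \<le> integral {0..p} (\<lambda>_. B)"
      unfolding J_def by (intro integral_norm_bound_integral Fint) (auto simp: F_def bnd)
    then show ?thesis using that by simp
  qed
  define P where "P w t = exp (- c * max 0 t) *\<^sub>R J w (max 0 t)" for w t
  have "P w \<in> bcontfun" for w
  proof (rule bcontfun_normI)
    show "continuous_on UNIV (P w)"
      unfolding P_def
      by (intro continuous_intros continuous_on_compose2[OF Jcont]) (auto simp: max_def)
    fix t :: real
    define p where "p = max 0 t"
    have p: "p \<ge> 0" by (simp add: p_def)
    have "c * p \<le> exp (c * p)" using exp_ge_add_one_self[of "c * p"] by linarith
    then have "p * B \<le> exp (c * p) * (B / c)"
      using mult_right_mono[of "c * p" "exp (c * p)" "B / c"] B0 c by simp
    then have "norm (J w p) \<le> exp (c * p) * (B / c)" using Jbnd[OF p, of w] by linarith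
    then have "exp (- c * p) * norm (J w p) \<le> exp (- c * p) * (exp (c * p) * (B / c))"
      by (intro mult_left_mono) auto
    also have "\<dots> = B / c" by (simp add: exp_minus field_simps)
    finally show "norm (P w t) \<le> B / c" by (simp add: P_def p_def)
  qed
  then have app: "apply_bcontfun (Bcontfun (P w)) = P w" for w
    by (simp add: Bcontfun_inverse)
  have "\<exists>!w. Bcontfun (P w) = w"
  proof (rule banach_fix_type[where c = "1/2"]; (intro allI)?)
    fix w1 w2 :: "real \<Rightarrow>\<^sub>C 'a"
    define d where "d = dist w1 w2"
    show "dist (Bcontfun (P w1)) (Bcontfun (P w2)) \<le> 1/2 * dist w1 w2"
    proof (rule dist_bound, unfold app)
      fix t :: real
      define p where "p = max 0 t"
      have p: "p \<ge> 0" by (simp add: p_def)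
      have Fd: "norm (F w1 s - F w2 s) \<le> L * d * exp (c * s)" for s
      proof -
        have "norm (F w1 s - F w2 s) \<le> L * norm (exp (c * s) *\<^sub>R (apply_bcontfun w1 s - apply_bcontfun w2 s))"
          using lipschitz_on_normD[OF lip, of "w0 + exp (c * s) *\<^sub>R apply_bcontfun w1 s"
              "w0 + exp (c * s) *\<^sub>R apply_bcontfun w2 s"]
          by (simp add: F_def scaleR_diff_right)
        also have "\<dots> = L * (exp (c * s) * dist (apply_bcontfun w1 s) (apply_bcontfun w2 s))"
          by (simp add: dist_norm)
        also have "\<dots> \<le> L * (exp (c * s) * d)"
          unfolding d_def using dist_bounded[of w1 s w2] L0 by (intro mult_left_mono) auto
        finally show ?thesis by (simp add: mult_ac)
      qed
      have int: "((\<lambda>s. L * d * exp (c * s)) has_integral (L * d * exp (c * p) / c - L * d * exp (c * 0) / c)) {0..p}"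
        using p c by (intro fundamental_theorem_of_calculus)
          (auto intro!: derivative_eq_intros simp flip: has_real_derivative_iff_has_vector_derivative)
      have "norm (J w1 p - J w2 p) = norm (integral {0..p} (\<lambda>s. F w1 s - F w2 s))"
        unfolding J_def using Fint by (simp add: integral_diff)
      also have "\<dots> \<le> integral {0..p} (\<lambda>s. L * d * exp (c * s))"
        using Fd by (intro integral_norm_bound_integral integrable_diff Fint)
          (use int in \<open>auto simp: has_integral_iff\<close>)
      also have "\<dots> \<le> L * d * exp (c * p) / c"
        using int L0 c by (simp add: has_integral_iff d_def)
      finally have "exp (- c * p) * norm (J w1 p - J w2 p) \<le> exp (- c * p) * (L * d * exp (c * p) / c)"
        by (intro mult_left_mono) auto
      also have "\<dots> = L / c * d" by (simp add: exp_minus field_simps)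
      also have "\<dots> \<le> 1 / 2 * d" using c by (intro mult_right_mono) (auto simp: d_def)
      finally show "dist (P w1 t) (P w2 t) \<le> 1 / 2 * dist w1 w2"
        by (simp add: P_def p_def d_def dist_norm flip: scaleR_diff_right)
    qed
  qed auto
  then obtain w where "Bcontfun (P w) = w" by blast
  then have w: "apply_bcontfun w = P w" using app[of w] by simp
  have eq: "w0 + exp (c * t) *\<^sub>R apply_bcontfun w t = w0 + J w t" if "t \<ge> 0" for t
    using that by (simp add: w P_def exp_minus)
  show ?thesis
  proof (intro exI[of _ "\<lambda>t. w0 + J w t"] conjI allI impI)
    show "w0 + J w 0 = w0" by (simp add: J_def)
    fix t :: real assume t: "t \<ge> 0"
    have "((\<lambda>t. w0 + J w t) has_vector_derivative 0 + F w t) (at t within {0..})"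
      by (intro has_vector_derivative_add Jder t) auto
    then show "((\<lambda>t. w0 + J w t) has_vector_derivative V (w0 + J w t)) (at t within {0..})"
      using eq[OF t] by (simp add: F_def)
  qed
qed

lemma first_hitting_time:
  fixes v :: "real \<Rightarrow> real"
  assumes "0 \<le> t" "continuous_on {0..t} v" "v 0 \<le> c" "c \<le> v t"
  shows "\<exists>s\<in>{0..t}. v s = c \<and> (\<forall>r\<in>{0..s}. v r \<le> c)"
proof -
  have hit: "\<exists>r'\<in>{0..r}. v r' = c" if "r \<in> {0..t}" "c \<le> v r" for r
  proof -
    have "continuous_on {0..r} v"
      using that by (intro continuous_on_subset[OF assms(2)]) auto
    then show ?thesis using IVT'[of v 0 c r] that assms by auto
  qed
  define E where "E = {s \<in> {0..t}. v s = c}"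
  have "closed E"
    unfolding E_def by (rule continuous_closed_preimage_constant) (use assms in auto)
  moreover have "E \<noteq> {}" "bdd_below E"
    using hit[of t] assms by (auto simp: E_def bdd_below_def)
  ultimately have "Inf E \<in> E" by (intro closed_contains_Inf)
  moreover have "v r \<le> c" if r: "0 \<le> r" "r \<le> Inf E" for r
  proof (rule ccontr)
    assume "\<not> v r \<le> c"
    moreover have "r \<in> {0..t}" using r \<open>Inf E \<in> E\<close> by (auto simp: E_def)
    ultimately obtain r' where "r' \<in> {0..r}" "v r' = c" using hit[of r] by auto
    then have "Inf E \<le> r'"
      using \<open>r \<in> {0..t}\<close> by (intro cInf_lower \<open>bdd_below E\<close>) (auto simp: E_def)
    then have "r' = r" using \<open>r' \<in> {0..r}\<close> r by auto
    then show False using \<open>v r' = c\<close> \<open>\<not> v r \<le> c\<close> by simp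
  qed
  ultimately show ?thesis by (intro bexI[of _ "Inf E"]) (auto simp: E_def)
qed

text \<open>
  Composing the field with the projection to a ball of radius larger than the a priori bound makes it
  globally Lipschitz and bounded without changing it inside the ball. If the solution of the modified
  equation reached the boundary, then up to the first such time it would solve the original equation
  and would violate the a priori bound there.
\<close>

lemma ode_global_solution_of_apriori_bound:
  fixes V :: "'a::euclidean_space \<Rightarrow> 'a"
  assumes lip: "\<And>r. \<exists>L. L-lipschitz_on (cball 0 r) V"
    and apriori: "\<And>W T. W 0 = w0 \<Longrightarrow> T \<ge> 0 \<Longrightarrow>
       (\<And>t. t \<in> {0..T} \<Longrightarrow> (W has_vector_derivative V (W t)) (at t within {0..T})) \<Longrightarrow> norm (W T) \<le> M"
  shows "\<exists>W. W 0 = w0 \<and> (\<forall>t\<ge>0. (W has_vector_derivative V (W t)) (at t within {0..}))"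
proof -
  define S where "S = cball (0::'a) (\<bar>M\<bar> + 1)"
  have S: "convex S" "closed S" "S \<noteq> {}" "compact S" by (auto simp: S_def)
  obtain L where L: "L-lipschitz_on S V" using lip by (auto simp: S_def)
  define U where "U x = V (closest_point S x)" for x
  have "(L * 1)-lipschitz_on UNIV (\<lambda>x. V (closest_point S x))"
  proof (rule lipschitz_on_compose2[where g = V])
    show "1-lipschitz_on UNIV (closest_point S)"
      using closest_point_lipschitz[OF S(1-3)] by (auto simp: lipschitz_on_def)
    show "L-lipschitz_on (range (closest_point S)) V"
      using L closest_point_in_set[OF S(2,3)] by (auto intro: lipschitz_on_subset)
  qed
  then have U: "L-lipschitz_on UNIV U" by (simp add: U_def[abs_def])
  have "compact (V ` S)"
    using lipschitz_on_continuous_on[OF L] S(4) by (rule compact_continuous_image)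
  then obtain B where "\<And>x. x \<in> S \<Longrightarrow> norm (V x) \<le> B"
    using compact_imp_bounded bounded_iff by (metis imageI)
  then have "norm (U x) \<le> B" for x
    using closest_point_in_set[OF S(2,3)] by (simp add: U_def)
  from lipschitz_bounded_ode_solution[OF U this] obtain W where
    W: "W 0 = w0" "\<And>t. t \<ge> 0 \<Longrightarrow> (W has_vector_derivative U (W t)) (at t within {0..})"
    by blast
  have UV: "U x = V x" if "norm x \<le> \<bar>M\<bar> + 1" for x
    using that by (simp add: U_def S_def closest_point_self)
  have bound: "norm (W T) \<le> M" if "T \<ge> 0" "\<And>t. t \<in> {0..T} \<Longrightarrow> norm (W t) \<le> \<bar>M\<bar> + 1" for T
  proof (rule apriori[of W, OF W(1) that(1)])
    fix t assume t: "t \<in> {0..T}"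
    then have "(W has_vector_derivative U (W t)) (at t within {0..T})"
      by (intro has_vector_derivative_within_subset[OF W(2)]) auto
    then show "(W has_vector_derivative V (W t)) (at t within {0..T})"
      using UV that(2)[OF t] by simp
  qed
  have Wc: "continuous_on {0..} W"
    by (auto simp: continuous_on_eq_continuous_within intro!: has_vector_derivative_continuous W)
  have inside: "norm (W t) < \<bar>M\<bar> + 1" if t0: "t \<ge> 0" for t
  proof (rule ccontr)
    assume "\<not> norm (W t) < \<bar>M\<bar> + 1"
    moreover have "continuous_on {0..t} (\<lambda>t. norm (W t))"
      by (intro continuous_on_norm continuous_on_subset[OF Wc]) auto
    moreover have "norm (W 0) \<le> M"
      using W(1) by (intro apriori[of W 0])
        (auto simp: has_vector_derivative_def has_derivative_within at_within_def bounded_linear_scaleR_left)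
    ultimately obtain s where s: "0 \<le> s" "norm (W s) = \<bar>M\<bar> + 1" "\<And>r. r \<in> {0..s} \<Longrightarrow> norm (W r) \<le> \<bar>M\<bar> + 1"
      using t0 first_hitting_time[of t "\<lambda>t. norm (W t)" "\<bar>M\<bar> + 1"] by fastforce
    have "norm (W s) \<le> M" using s(1,3) by (rule bound)
    then show False using s(2) by linarith
  qed
  show ?thesis
    using W inside UV by (intro exI[of _ W]) (auto simp: less_imp_le)
qed

section \<open>Coordinates and the Jacobian of the output map\<close>

lemma pos_strict_mono: "i < j \<Longrightarrow> pos i < pos (j :: 'n::{finite,linorder})"
  unfolding pos_def by (intro psubset_card_mono) auto

lemma inj_pos: "inj (pos :: 'n::{finite,linorder} \<Rightarrow> nat)"
  by (rule injI) (metis less_irrefl linorder_neqE pos_strict_mono)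

lemma pos_less_card: "pos (i :: 'n::{finite,linorder}) < CARD('n)"
  unfolding pos_def by (intro psubset_card_mono) auto

lemma range_pos: "range (pos :: 'n::{finite,linorder} \<Rightarrow> nat) = {..<CARD('n)}"
  by (rule card_subset_eq) (auto simp: pos_less_card card_image[OF inj_pos])

lemma coord_pos: "coord (pos i) = (i :: 'n::{finite,linorder})"
  unfolding coord_def using injD[OF inj_pos] by (intro the_equality) auto

lemma pos_coord:
  assumes "m < CARD('n)"
  shows "pos (coord m :: 'n::{finite,linorder}) = m"
proof -
  have "m \<in> range (pos :: 'n \<Rightarrow> nat)" using assms by (simp add: range_pos)
  then show ?thesis by (auto simp: coord_pos)
qed

lemma matrix_inv_left:
  fixes A :: "real ^ 'n ^ 'n"
  assumes "invertible A"
  shows "matrix_inv A ** A = mat 1"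
  using assms unfolding invertible_def matrix_inv_def by (rule someI2_ex) simp

locale affine_system =
  fixes f g :: "('n::{finite,linorder}) vect \<Rightarrow> 'n vect" and h :: "'n vect \<Rightarrow> real" and b :: real
  assumes smooth_f: "smooth f" and smooth_g: "smooth g" and smooth_h: "smooth h"
    and reldeg: "uniform_relative_degree b f g h"
begin

abbreviation "\<Phi> \<equiv> Phi f h"

lemma lie_deriv_input_eq_0: "i + 2 \<le> CARD('n) \<Longrightarrow> lie_deriv g (lie_iter f i h) x = 0"
  using reldeg by (simp add: uniform_relative_degree_def)

lemma input_gain_nonzero: "lie_deriv g (lie_iter f (CARD('n) - 1) h) x \<noteq> 0"
  and input_gain_ge: "input_gain f g h x \<ge> b"
  using reldeg by (auto simp: uniform_relative_degree_def input_gain_def)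

lemma smooth_output: "smooth (lie_iter f i h)"
  by (rule smooth_lie_iter[OF smooth_f smooth_h])

lemma smooth_iterated_bracket: "smooth ((lie_bracket f ^^ j) g)"
  by (induction j) (auto intro: smooth_g smooth_lie_bracket smooth_f)

text \<open>
  Moving one bracket from the field to the function costs a sign, because the remaining term of
  \<open>lie_deriv_lie_bracket\<close> differentiates a function that vanishes identically by the relative degree.
\<close>

lemma lie_deriv_iterated_bracket:
  "i + j < CARD('n) \<Longrightarrow>
   lie_deriv ((lie_bracket f ^^ j) g) (lie_iter f i h) x = (-1) ^ j * lie_deriv g (lie_iter f (i + j) h) x"
proof (induction j arbitrary: i x)
  case (Suc j)
  let ?X = "(lie_bracket f ^^ j) g"
  have "lie_deriv ?X (lie_iter f i h) = (\<lambda>_. 0)"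
    using Suc by (auto simp: lie_deriv_input_eq_0)
  then have "lie_deriv f (lie_deriv ?X (lie_iter f i h)) x = 0"
    by (simp add: lie_deriv_def partial_deriv_def)
  moreover have "lie_deriv ?X (lie_iter f (Suc i) h) x = (-1) ^ j * lie_deriv g (lie_iter f (Suc i + j) h) x"
    using Suc.prems by (intro Suc.IH) simp
  ultimately show ?case
    using lie_deriv_lie_bracket[OF smooth_f smooth_iterated_bracket smooth_output, of j i x]
    by (simp add: lie_iter_Suc)
qed simp

lemma Phi_has_derivative:
  "(\<Phi> has_derivative (\<lambda>v. \<chi> i. frechet_derivative (lie_iter f (pos i) h) (at x) v)) (at x)"
proof (rule iffD2[OF has_derivative_componentwise_within], rule ballI)
  fix e :: "'n vect" assume "e \<in> Basis"
  then obtain k where e: "e = axis k 1" by (auto simp: Basis_vec_def)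
  have "(lie_iter f (pos k) h has_derivative frechet_derivative (lie_iter f (pos k) h) (at x)) (at x)"
    by (rule smooth_has_derivative[OF smooth_output])
  then show "((\<lambda>x. \<Phi> x \<bullet> e) has_derivative
      (\<lambda>v. (\<chi> i. frechet_derivative (lie_iter f (pos i) h) (at x) v) \<bullet> e)) (at x)"
    by (simp add: e inner_axis Phi_def)
qed

lemma jacobian_Phi_has_derivative: "(\<Phi> has_derivative (*v) (jacobian \<Phi> (at x))) (at x)"
  using Phi_has_derivative[of x] jacobian_works[of \<Phi> "at x"] by (auto simp: differentiable_def)

lemma jacobian_Phi_nth:
  "(jacobian \<Phi> (at x) *v v) $ i = frechet_derivative (lie_iter f (pos i) h) (at x) v"
  using fun_cong[OF has_derivative_unique[OF jacobian_Phi_has_derivative Phi_has_derivative, of x], of v]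
  by simp

text \<open>
  Applied to the fields \<open>g, ad\<^sub>f g, \<dots>, ad\<^sub>f\<^sup>n\<^sup>-\<^sup>1 g\<close>, the rows of the Jacobian form an antitriangular
  matrix whose antidiagonal entries are \<open>\<plusminus> L\<^sub>g L\<^sub>f\<^sup>n\<^sup>-\<^sup>1 h\<close>, which do not vanish. So a linear relation between
  the rows is trivial, as one sees by testing it with \<open>g\<close> first, which kills the last coefficient,
  then with \<open>ad\<^sub>f g\<close>, and so on.
\<close>

lemma invertible_jacobian_Phi: "invertible (jacobian \<Phi> (at x))"
  unfolding invertible_right_inverse matrix_right_invertible_independent_rows
proof (intro allI impI)
  let ?J = "jacobian \<Phi> (at x)"
  fix c :: "'n \<Rightarrow> real" and i
  assume 0: "(\<Sum>i\<in>UNIV. c i *s row i ?J) = 0"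
  have eq0: "(\<Sum>i\<in>UNIV. c i * frechet_derivative (lie_iter f (pos i) h) (at x) v) = 0" for v
  proof -
    have "(\<Sum>i\<in>UNIV. c i * (?J *v v) $ i) = (\<Sum>i\<in>UNIV. c i *s row i ?J) \<bullet> v"
    proof -
      have "(?J *v v) $ k = row k ?J \<bullet> v" for k
        by (simp add: row_def matrix_vector_mult_def inner_vec_def)
      then show ?thesis by (simp add: inner_sum_left scalar_mult_eq_scaleR)
    qed
    then show ?thesis using 0 by (simp add: jacobian_Phi_nth)
  qed
  show "c i = 0"
  proof (induction "CARD('n) - 1 - pos i" arbitrary: i rule: less_induct)
    case less
    let ?m = "CARD('n) - 1 - pos i"
    let ?v = "(lie_bracket f ^^ ?m) g x"
    let ?D = "\<lambda>k. frechet_derivative (lie_iter f (pos k) h) (at x) ?v"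
    have D: "?D k = lie_deriv ((lie_bracket f ^^ ?m) g) (lie_iter f (pos k) h) x" for k
      by (simp add: lie_deriv_eq_derivative smooth_output)
    have "c k * ?D k = 0" if "k \<noteq> i" for k
    proof (cases "pos k < pos i")
      case True
      then have "pos k + ?m + 2 \<le> CARD('n)" using pos_less_card[of i] by linarith
      then show ?thesis unfolding D by (simp add: lie_deriv_iterated_bracket lie_deriv_input_eq_0)
    next
      case False
      then have "pos i < pos k" using that injD[OF inj_pos] by (metis linorder_neqE_nat)
      then have "c k = 0" using pos_less_card[of k] by (intro less) linarith
      then show ?thesis by simp
    qed
    then have "(\<Sum>k\<in>UNIV. c k * ?D k) = (\<Sum>k\<in>{i}. c k * ?D k)"
      by (intro sum.mono_neutral_right) auto
    then have "c i * ?D i = 0" using eq0[of ?v] by simp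
    moreover have "pos i + ?m = CARD('n) - 1" using pos_less_card[of i] by linarith
    then have "?D i \<noteq> 0"
      unfolding D using pos_less_card[of i] input_gain_nonzero by (simp add: lie_deriv_iterated_bracket)
    ultimately show ?case by simp
  qed
qed

end

section \<open>A Lyapunov function for the perturbed integrator chain\<close>

lemma nonincreasing_of_derivative_nonpos:
  fixes v :: "real \<Rightarrow> real"
  assumes der: "\<And>t. t \<in> {0..T} \<Longrightarrow> (v has_real_derivative v' t) (at t within {0..T})"
    and neg: "\<And>t. t \<in> {0..T} \<Longrightarrow> v' t \<le> 0" and "0 \<le> T"
  shows "v T \<le> v 0"
proof (cases "T = 0")
  case False
  then obtain s where "s \<in> {0<..<T}" "v T - v 0 = v' s * (T - 0)"
    using mvt_simple[of 0 T v "\<lambda>t. (*) (v' t)"] der \<open>0 \<le> T\<close>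
    by (auto simp: has_field_derivative_def)
  moreover from this have "v' s * (T - 0) \<le> 0" using neg[of s] by (intro mult_nonpos_nonneg) auto
  ultimately show ?thesis by simp
qed simp

text \<open>
  The differential inequality is only known while \<open>v \<le> c\<close>. Starting below \<open>c\<close>, the function
  decreases as long as it stays there, so it can never come back to the level \<open>c\<close>.
\<close>

lemma exponential_decay_below_level:
  fixes v :: "real \<Rightarrow> real"
  assumes der: "\<And>t. t \<in> {0..T} \<Longrightarrow> (v has_real_derivative v' t) (at t within {0..T})"
    and dec: "\<And>t. t \<in> {0..T} \<Longrightarrow> v t \<le> c \<Longrightarrow> v' t \<le> - v t"
    and init: "0 \<le> v 0" "v 0 < c"
    and t: "t \<in> {0..T}"
  shows "v t \<le> v 0 * exp (- t)"
proof -
  have cont: "continuous_on {0..T} v"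
    by (auto simp: continuous_on_eq_continuous_within intro: DERIV_continuous der)
  have decay: "v s \<le> v 0 * exp (- s)" if s: "s \<in> {0..T}" "\<And>r. r \<in> {0..s} \<Longrightarrow> v r \<le> c" for s
  proof -
    have "v s * exp s \<le> v 0 * exp 0"
    proof (rule nonincreasing_of_derivative_nonpos[where v = "\<lambda>r. v r * exp r"])
      fix r assume r: "r \<in> {0..s}"
      then have "(v has_real_derivative v' r) (at r within {0..s})"
        using s by (intro DERIV_subset[OF der]) auto
      then show "((\<lambda>r. v r * exp r) has_real_derivative (v' r + v r) * exp r) (at r within {0..s})"
        by (auto intro!: derivative_eq_intros simp: algebra_simps)
      show "(v' r + v r) * exp r \<le> 0"
        using dec[of r] s r by (intro mult_nonpos_nonneg) auto
    qed (use s in auto)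
    then show ?thesis by (simp add: exp_minus field_simps)
  qed
  have below: "v s \<le> c" if s: "s \<in> {0..T}" for s
  proof (rule ccontr)
    assume "\<not> v s \<le> c"
    moreover have "continuous_on {0..s} v"
      using s by (intro continuous_on_subset[OF cont]) auto
    ultimately obtain u where u: "u \<in> {0..s}" "v u = c" "\<forall>r\<in>{0..u}. v r \<le> c"
      using first_hitting_time[of s v c] s init by force
    then have "c \<le> v 0 * exp (- u)" using decay[of u] s by auto
    also have "\<dots> \<le> v 0 * 1" using u init by (intro mult_left_mono) auto
    finally show False using init by simp
  qed
  show ?thesis using t by (intro decay below) auto
qed

text \<open>
  The coefficient of \<open>s\<^sup>i\<close> in \<open>(s + 2)\<^sup>j\<close>. If \<open>\<zeta> i\<close> is the \<open>i\<close>-th derivative of a function \<open>y\<close>, then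
  the sum \<open>filtered \<zeta> j\<close> below is \<open>(d/dt + 2)\<^sup>j y\<close>.
\<close>

definition filter_coeff :: "nat \<Rightarrow> nat \<Rightarrow> real" where
  "filter_coeff j i = real (j choose i) * 2 ^ (j - i)"

definition filtered :: "(nat \<Rightarrow> real) \<Rightarrow> nat \<Rightarrow> real" where
  "filtered \<zeta> j = (\<Sum>i\<le>j. filter_coeff j i * \<zeta> i)"

text \<open>
  One more factor \<open>d/dt + 2\<close>: the derivative acts on the sequence as a shift. This is Pascal's rule.
\<close>

lemma filtered_Suc: "filtered \<zeta> (Suc j) = filtered (\<lambda>i. \<zeta> (Suc i)) j + 2 * filtered \<zeta> j"
proof -
  have "2 * filtered \<zeta> j = (\<Sum>i\<le>Suc j. 2 * filter_coeff j i * \<zeta> i)"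
    by (simp add: filtered_def filter_coeff_def sum_distrib_left mult.assoc)
  also have "\<dots> = 2 * filter_coeff j 0 * \<zeta> 0 + (\<Sum>i\<le>j. 2 * filter_coeff j (Suc i) * \<zeta> (Suc i))"
    by (rule sum.atMost_Suc_shift)
  finally have "filtered (\<lambda>i. \<zeta> (Suc i)) j + 2 * filtered \<zeta> j = 2 * filter_coeff j 0 * \<zeta> 0
      + (\<Sum>i\<le>j. (filter_coeff j i + 2 * filter_coeff j (Suc i)) * \<zeta> (Suc i))"
    by (simp add: filtered_def sum.distrib algebra_simps)
  also have "\<dots> = filter_coeff (Suc j) 0 * \<zeta> 0 + (\<Sum>i\<le>j. filter_coeff (Suc j) (Suc i) * \<zeta> (Suc i))"
  proof -
    have "filter_coeff j i + 2 * filter_coeff j (Suc i) = filter_coeff (Suc j) (Suc i)" if "i \<le> j" for i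
    proof (cases "i = j")
      case False
      then have "j - i = Suc (j - Suc i)" using that by simp
      then show ?thesis by (simp add: filter_coeff_def algebra_simps)
    qed (simp add: filter_coeff_def)
    then show ?thesis by (simp add: filter_coeff_def)
  qed
  also have "\<dots> = filtered \<zeta> (Suc j)"
    unfolding filtered_def by (rule sum.atMost_Suc_shift[symmetric])
  finally show ?thesis by simp
qed

lemma abs_filtered_le: "(\<And>i. i \<le> j \<Longrightarrow> \<bar>\<zeta> i\<bar> \<le> m) \<Longrightarrow> \<bar>filtered \<zeta> j\<bar> \<le> 3 ^ j * m"
proof (induction j arbitrary: \<zeta>)
  case 0
  then show ?case by (simp add: filtered_def filter_coeff_def)
next
  case (Suc j)
  have "\<bar>filtered (\<lambda>i. \<zeta> (Suc i)) j\<bar> \<le> 3 ^ j * m" "\<bar>filtered \<zeta> j\<bar> \<le> 3 ^ j * m"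
    using Suc by auto
  then show ?case unfolding filtered_Suc power_Suc by linarith
qed

text \<open>
  The filter is inverted one factor at a time: by \<open>filtered_Suc\<close> the filtered values of the shifted
  sequence grow at most by the factor 3.
\<close>

lemma abs_le_filtered: "(\<And>i. i \<le> j \<Longrightarrow> \<bar>filtered \<zeta> i\<bar> \<le> m) \<Longrightarrow> \<bar>\<zeta> j\<bar> \<le> 3 ^ j * m"
proof (induction j arbitrary: \<zeta> m)
  case 0
  then show ?case by (simp add: filtered_def filter_coeff_def)
next
  case (Suc j)
  have "\<bar>filtered (\<lambda>i. \<zeta> (Suc i)) i\<bar> \<le> 3 * m" if "i \<le> j" for i
    using Suc.prems[of i] Suc.prems[of "Suc i"] that filtered_Suc[of \<zeta> i] by auto
  from Suc.IH[of "\<lambda>i. \<zeta> (Suc i)", OF this] show ?case by simp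
qed

lemma filtered_has_derivative:
  assumes "\<And>i. i \<le> j \<Longrightarrow> ((\<lambda>s. \<zeta> s i) has_real_derivative \<zeta>' i) (at t within S)"
  shows "((\<lambda>s. filtered (\<zeta> s) j) has_real_derivative filtered \<zeta>' j) (at t within S)"
  unfolding filtered_def by (intro DERIV_sum DERIV_cmult) (use assms in auto)

text \<open>
  When the initial errors are at most \<open>\<rho>\<close>, the Lyapunov function starts below the number under the
  root, and on the corresponding sublevel set all errors are at most this radius.
\<close>

definition trapping_radius :: "nat \<Rightarrow> real \<Rightarrow> real" where
  "trapping_radius n \<rho> = 3 ^ n * sqrt (real (n + 1) * (3 ^ n * \<rho>)\<^sup>2 + 1)"

text \<open>
  The essential part is \<open>(3 + M\<^sup>2) / (2 b)\<close>, where \<open>M\<close> measures the terms that the last gain has to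
  dominate in \<open>lyapunov_dissipation\<close>. The summand 1 serves to keep \<open>k\<^sub>0\<close> above 1 as well.
\<close>

definition gain_threshold :: "nat \<Rightarrow> real \<Rightarrow> real \<Rightarrow> real \<Rightarrow> real" where
  "gain_threshold n b L \<Gamma> = 1 + (3 + ((3 ^ n + L + real n * \<Gamma>) * 3 ^ n)\<^sup>2) / (2 * b)"

text \<open>
  With \<open>\<eta> = filtered \<zeta>\<close>, the components \<open>j < n\<close> satisfy \<open>\<eta>\<^sub>j' = \<eta>\<^sub>j\<^sub>+\<^sub>1 - 2 \<eta>\<^sub>j\<close> and contribute at
  most \<open>v - 3 (v - \<eta>\<^sub>n\<^sup>2)\<close>. The last one satisfies \<open>\<eta>\<^sub>n' = S - G k\<^sub>n \<eta>\<^sub>n\<close> with \<open>\<bar>S\<bar> \<le> M \<surd>v\<close> and contributes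
  at most \<open>v + M\<^sup>2 \<eta>\<^sub>n\<^sup>2 - 2 G k\<^sub>n \<eta>\<^sub>n\<^sup>2\<close>. The total is \<open>- v + (3 + M\<^sup>2 - 2 G k\<^sub>n) \<eta>\<^sub>n\<^sup>2\<close>, and the threshold
  for \<open>k\<^sub>n\<close> makes the last coefficient nonpositive. The deviation of the gains from their nominal ratios enters
  \<open>M\<close> with a bound that does not grow with \<open>k\<^sub>n\<close>, which is why it is limited absolutely and not
  relative to \<open>k\<^sub>n\<close>.
\<close>

lemma lyapunov_dissipation:
  fixes \<zeta> \<zeta>' k :: "nat \<Rightarrow> real"
  assumes b: "b > 0" and bounds: "\<bar>\<Delta>\<bar> \<le> L * m" "b \<le> G" "G \<le> \<Gamma>"
    and chain: "\<And>i. i < n \<Longrightarrow> \<zeta>' i = \<zeta> (Suc i)"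
    and last: "\<zeta>' n = \<Delta> - G * (\<Sum>j\<le>n. k j * \<zeta> j)"
    and gains: "\<And>j. j < n \<Longrightarrow> \<bar>k j - filter_coeff n j * k n\<bar> \<le> 1" "k n \<ge> gain_threshold n b L \<Gamma>"
    and v: "v = (\<Sum>j\<le>n. (filtered \<zeta> j)\<^sup>2)"
    and m: "m = 3 ^ n * sqrt v" "\<And>i. i \<le> n \<Longrightarrow> \<bar>\<zeta> i\<bar> \<le> m"
  shows "(\<Sum>j\<le>n. 2 * filtered \<zeta> j * filtered \<zeta>' j) \<le> - v"
proof -
  define \<eta> where "\<eta> = filtered \<zeta>"
  define A where "A = (\<Sum>j<n. (\<eta> j)\<^sup>2)"
  define M where "M = (3 ^ n + L + real n * \<Gamma>) * 3 ^ n"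
  have vA: "v = A + (\<eta> n)\<^sup>2" by (simp add: v A_def \<eta>_def flip: lessThan_Suc_atMost)
  have v0: "v \<ge> 0" by (simp add: v sum_nonneg)
  have m0: "m \<ge> 0" using v0 by (simp add: m)
  have G0: "G \<ge> 0" "\<Gamma> \<ge> 0" using b bounds by auto
  have step: "filtered \<zeta>' j = \<eta> (Suc j) - 2 * \<eta> j" if "j < n" for j
  proof -
    have "filtered \<zeta>' j = filtered (\<lambda>i. \<zeta> (Suc i)) j"
      unfolding filtered_def using that chain by (intro sum.cong) auto
    then show ?thesis by (simp add: \<eta>_def filtered_Suc)
  qed
  have "(\<Sum>j<n. 2 * \<eta> j * filtered \<zeta>' j) \<le> (\<Sum>j<n. (\<eta> (Suc j))\<^sup>2 - 3 * (\<eta> j)\<^sup>2)"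
  proof (intro sum_mono)
    fix j assume "j \<in> {..<n}"
    have "0 \<le> (\<eta> (Suc j) - \<eta> j)\<^sup>2" by simp
    then show "2 * \<eta> j * filtered \<zeta>' j \<le> (\<eta> (Suc j))\<^sup>2 - 3 * (\<eta> j)\<^sup>2"
      unfolding step[OF \<open>j \<in> {..<n}\<close>[simplified]] by (simp add: algebra_simps power2_eq_square)
  qed
  also have "\<dots> = (\<Sum>j<n. (\<eta> (Suc j))\<^sup>2) - 3 * A"
    by (simp add: sum_subtractf A_def sum_distrib_left)
  also have "(\<Sum>j<n. (\<eta> (Suc j))\<^sup>2) \<le> v"
  proof -
    have "v = (\<eta> 0)\<^sup>2 + (\<Sum>j<n. (\<eta> (Suc j))\<^sup>2)"
      unfolding v \<eta>_def[symmetric] lessThan_Suc_atMost[symmetric] by (rule sum.lessThan_Suc_shift)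
    then show ?thesis by simp
  qed
  finally have lower: "(\<Sum>j<n. 2 * \<eta> j * filtered \<zeta>' j) \<le> v - 3 * A" by simp
  define P where "P = filtered (\<lambda>i. if i < n then \<zeta> (Suc i) else 0) n"
  define E where "E = (\<Sum>j<n. (k j - filter_coeff n j * k n) * \<zeta> j)"
  define S where "S = P + \<Delta> - G * E"
  have P: "\<bar>P\<bar> \<le> 3 ^ n * m"
    unfolding P_def using m0 m(2) by (intro abs_filtered_le) auto
  have E: "\<bar>E\<bar> \<le> real n * m"
  proof -
    have "\<bar>E\<bar> \<le> (\<Sum>j<n. \<bar>(k j - filter_coeff n j * k n) * \<zeta> j\<bar>)" unfolding E_def by (rule sum_abs)
    also have "\<dots> \<le> (\<Sum>j<n. 1 * m)"
      unfolding abs_mult using gains(1) m(2) by (intro sum_mono mult_mono) auto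
    finally show ?thesis by simp
  qed
  have S: "\<bar>S\<bar> \<le> M * sqrt v"
  proof -
    have "\<bar>G * E\<bar> \<le> \<Gamma> * (real n * m)"
      unfolding abs_mult using E G0 bounds by (intro mult_mono) auto
    then have "\<bar>S\<bar> \<le> 3 ^ n * m + L * m + \<Gamma> * (real n * m)"
      unfolding S_def using P bounds(1) by linarith
    then show ?thesis by (simp add: M_def m algebra_simps)
  qed
  have sumk: "(\<Sum>j\<le>n. k j * \<zeta> j) = k n * \<eta> n + E"
  proof -
    have "\<eta> n = (\<Sum>j<n. filter_coeff n j * \<zeta> j) + \<zeta> n"
      by (simp add: \<eta>_def filtered_def filter_coeff_def flip: lessThan_Suc_atMost)
    then show ?thesis
      by (simp add: E_def sum_subtractf sum_distrib_left algebra_simps flip: lessThan_Suc_atMost)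
  qed
  have "filtered \<zeta>' n = (\<Sum>i<n. filter_coeff n i * \<zeta>' i) + \<zeta>' n"
    by (simp add: filtered_def filter_coeff_def flip: lessThan_Suc_atMost)
  also have "(\<Sum>i<n. filter_coeff n i * \<zeta>' i) = P"
    unfolding P_def filtered_def lessThan_Suc_atMost[symmetric]
    using chain by (simp add: filter_coeff_def)
  finally have last': "filtered \<zeta>' n = S - G * k n * \<eta> n"
    unfolding last sumk S_def by (simp add: algebra_simps)
  have k: "3 + M\<^sup>2 \<le> 2 * (G * k n)"
  proof -
    have "(3 + M\<^sup>2) / (2 * b) \<le> k n"
      using gains(2) by (simp add: gain_threshold_def M_def)
    then have "3 + M\<^sup>2 \<le> 2 * (b * k n)" using b by (simp add: field_simps)
    moreover have "0 \<le> k n"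
      by (rule order_trans[OF _ \<open>(3 + M\<^sup>2) / (2 * b) \<le> k n\<close>]) (use b in simp)
    then have "b * k n \<le> G * k n" using bounds by (intro mult_right_mono) auto
    ultimately show ?thesis by linarith
  qed
  have "2 * (\<eta> n * S) \<le> v + M\<^sup>2 * (\<eta> n)\<^sup>2"
  proof -
    have "\<eta> n * S \<le> \<bar>\<eta> n\<bar> * (M * sqrt v)"
      using abs_ge_self[of "\<eta> n * S"] mult_left_mono[OF S abs_ge_zero[of "\<eta> n"]]
      unfolding abs_mult by linarith
    moreover have "0 \<le> (sqrt v - M * \<bar>\<eta> n\<bar>)\<^sup>2" by simp
    then have "2 * (\<bar>\<eta> n\<bar> * (M * sqrt v)) \<le> v + M\<^sup>2 * (\<eta> n)\<^sup>2"
      using v0 by (simp add: power2_diff power_mult_distrib algebra_simps)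
    ultimately show ?thesis by linarith
  qed
  moreover have "(3 + M\<^sup>2) * (\<eta> n)\<^sup>2 \<le> 2 * (G * k n) * (\<eta> n)\<^sup>2"
    using k by (rule mult_right_mono) simp
  moreover have "2 * \<eta> n * filtered \<zeta>' n = 2 * (\<eta> n * S) - 2 * (G * k n) * (\<eta> n)\<^sup>2"
    by (simp add: last' algebra_simps power2_eq_square)
  moreover have "(\<Sum>j\<le>n. 2 * filtered \<zeta> j * filtered \<zeta>' j)
      = (\<Sum>j<n. 2 * \<eta> j * filtered \<zeta>' j) + 2 * \<eta> n * filtered \<zeta>' n"
    by (simp add: \<eta>_def flip: lessThan_Suc_atMost)
  ultimately show ?thesis using lower vA by (simp add: algebra_simps)
qed

text \<open>
  The hypothesis on \<open>\<Delta>\<close> and \<open>G\<close> is only required inside the trapping radius; the sublevel set of the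
  Lyapunov function that contains the initial errors is never left.
\<close>

lemma integrator_chain_decay:
  fixes \<zeta> :: "real \<Rightarrow> nat \<Rightarrow> real" and \<Delta> G :: "real \<Rightarrow> real" and k :: "nat \<Rightarrow> real"
  assumes b: "b > 0"
    and chain: "\<And>t i. t \<in> {0..T} \<Longrightarrow> i < n \<Longrightarrow>
      ((\<lambda>s. \<zeta> s i) has_real_derivative \<zeta> t (Suc i)) (at t within {0..T})"
    and last: "\<And>t. t \<in> {0..T} \<Longrightarrow>
      ((\<lambda>s. \<zeta> s n) has_real_derivative \<Delta> t - G t * (\<Sum>j\<le>n. k j * \<zeta> t j)) (at t within {0..T})"
    and region: "\<And>t m. t \<in> {0..T} \<Longrightarrow> m \<le> trapping_radius n \<rho> \<Longrightarrow> (\<And>i. i \<le> n \<Longrightarrow> \<bar>\<zeta> t i\<bar> \<le> m) \<Longrightarrow>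
      \<bar>\<Delta> t\<bar> \<le> L * m \<and> b \<le> G t \<and> G t \<le> \<Gamma>"
    and gains: "\<And>j. j < n \<Longrightarrow> \<bar>k j - filter_coeff n j * k n\<bar> \<le> 1" "k n \<ge> gain_threshold n b L \<Gamma>"
    and init: "\<And>i. i \<le> n \<Longrightarrow> \<bar>\<zeta> 0 i\<bar> \<le> \<rho>"
    and t: "t \<in> {0..T}" and i: "i \<le> n"
  shows "\<bar>\<zeta> t i\<bar> \<le> trapping_radius n \<rho> * exp (- t / 2)"
proof -
  define c where "c = real (n + 1) * (3 ^ n * \<rho>)\<^sup>2 + 1"
  have c0: "c > 0" by (simp add: c_def add_nonneg_pos)
  define v where "v s = (\<Sum>j\<le>n. (filtered (\<zeta> s) j)\<^sup>2)" for s
  define \<zeta>' where "\<zeta>' s i = (if i < n then \<zeta> s (Suc i) else \<Delta> s - G s * (\<Sum>j\<le>n. k j * \<zeta> s j))" for s i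
  have v0: "v s \<ge> 0" for s by (simp add: v_def sum_nonneg)
  have \<zeta>v: "\<bar>\<zeta> s i\<bar> \<le> 3 ^ n * sqrt (v s)" if "i \<le> n" for s i
  proof -
    have "\<bar>filtered (\<zeta> s) j\<bar> \<le> sqrt (v s)" if "j \<le> n" for j
    proof -
      have "(filtered (\<zeta> s) j)\<^sup>2 \<le> v s"
        unfolding v_def using that by (intro member_le_sum) auto
      then show ?thesis using real_le_rsqrt[of "\<bar>filtered (\<zeta> s) j\<bar>"] by simp
    qed
    then have "\<bar>\<zeta> s i\<bar> \<le> 3 ^ i * sqrt (v s)" using that by (intro abs_le_filtered) auto
    also have "\<dots> \<le> 3 ^ n * sqrt (v s)"
      using that v0 by (intro mult_right_mono power_increasing) auto
    finally show ?thesis .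
  qed
  have \<zeta>der: "((\<lambda>s. \<zeta> s i) has_real_derivative \<zeta>' s i) (at s within {0..T})" if "s \<in> {0..T}" "i \<le> n" for s i
    using chain[OF that(1)] last[OF that(1)] that by (cases "i < n") (auto simp: \<zeta>'_def)
  have vder: "(v has_real_derivative (\<Sum>j\<le>n. 2 * filtered (\<zeta> s) j * filtered (\<zeta>' s) j)) (at s within {0..T})"
    if "s \<in> {0..T}" for s
    unfolding v_def[abs_def]
    by (intro DERIV_sum)
      (auto intro!: derivative_eq_intros filtered_has_derivative \<zeta>der that)
  have decay: "(\<Sum>j\<le>n. 2 * filtered (\<zeta> s) j * filtered (\<zeta>' s) j) \<le> - v s"
    if s: "s \<in> {0..T}" "v s \<le> c" for s
  proof (rule lyapunov_dissipation[where m = "3 ^ n * sqrt (v s)"])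
    have "3 ^ n * sqrt (v s) \<le> trapping_radius n \<rho>"
      using s by (simp add: trapping_radius_def c_def)
    from region[OF s(1) this \<zeta>v]
    show "\<bar>\<Delta> s\<bar> \<le> L * (3 ^ n * sqrt (v s))" "b \<le> G s" "G s \<le> \<Gamma>" by auto
  qed (use b gains \<zeta>v in \<open>auto simp: \<zeta>'_def v_def\<close>)
  have "v 0 < c"
  proof -
    have "(filtered (\<zeta> 0) j)\<^sup>2 \<le> (3 ^ n * \<rho>)\<^sup>2" if "j \<le> n" for j
    proof -
      have \<rho>: "\<rho> \<ge> 0" using init[of 0] by linarith
      have "\<bar>filtered (\<zeta> 0) j\<bar> \<le> 3 ^ j * \<rho>" using that init by (intro abs_filtered_le) auto
      also have "\<dots> \<le> 3 ^ n * \<rho>" using that \<rho> by (intro mult_right_mono power_increasing) auto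
      finally show ?thesis using \<rho> by (simp flip: abs_le_square_iff)
    qed
    then have "v 0 \<le> (\<Sum>j\<le>n. (3 ^ n * \<rho>)\<^sup>2)" unfolding v_def by (intro sum_mono) auto
    then show ?thesis by (simp add: c_def)
  qed
  then have "v t \<le> v 0 * exp (- t)"
    by (intro exponential_decay_below_level[OF vder decay]) (use v0 t in auto)
  also have "\<dots> \<le> c * (exp (- t / 2))\<^sup>2"
    using \<open>v 0 < c\<close> by (intro mult_mono) (use c0 in \<open>auto simp flip: exp_double\<close>)
  finally have "sqrt (v t) \<le> sqrt c * exp (- t / 2)"
    using real_sqrt_le_mono by (fastforce simp: real_sqrt_mult)
  then have "3 ^ n * sqrt (v t) \<le> 3 ^ n * (sqrt c * exp (- t / 2))" by (rule mult_left_mono) simp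
  moreover have "trapping_radius n \<rho> * exp (- t / 2) = 3 ^ n * (sqrt c * exp (- t / 2))"
    by (simp add: trapping_radius_def c_def)
  ultimately show ?thesis using \<zeta>v[OF i, of t] by linarith
qed

section \<open>The growth bound near the equilibrium\<close>

text \<open>
  Near \<open>0\<close> this is the limsup condition; away from \<open>0\<close> monotonicity bounds \<open>\<tau>2\<close> by its value at the
  right end. At \<open>0\<close> itself monotonicity and the bound nearby force \<open>\<tau>2 0 = 0\<close>.
\<close>

lemma tau2_linear_bound:
  assumes "admissible_data b \<tau>1 \<tau>2"
  shows "\<exists>L\<ge>0. \<forall>s. 0 \<le> s \<and> s \<le> r \<longrightarrow> \<tau>2 s \<le> L * s"
proof -
  have mono: "\<tau>2 s \<le> \<tau>2 s'" if "0 \<le> s" "s \<le> s'" for s s'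
    using assms that unfolding admissible_data_def mono_on_def by auto
  have nonneg: "0 \<le> \<tau>2 s" if "0 \<le> s" for s using assms that by (simp add: admissible_data_def)
  have "Limsup (at_right 0) (\<lambda>r. ereal (\<tau>2 r / r)) < \<infinity>" using assms by (simp add: admissible_data_def)
  then obtain z where "Limsup (at_right 0) (\<lambda>r. ereal (\<tau>2 r / r)) < ereal z"
    using ereal_dense2 by blast
  then have "\<forall>\<^sub>F s in at_right 0. ereal (\<tau>2 s / s) < ereal z" by (rule Limsup_lessD)
  then obtain s0 where s0: "s0 > 0" "\<And>s. 0 < s \<Longrightarrow> s < s0 \<Longrightarrow> \<tau>2 s / s < z"
    by (auto simp: eventually_at_right_field)
  define N where "N = \<bar>z\<bar>"
  have N: "N \<ge> 0" by (simp add: N_def)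
  have near: "\<tau>2 s \<le> N * s" if "0 < s" "s < s0" for s
  proof -
    have "\<tau>2 s / s \<le> N" using s0(2)[OF that] by (simp add: N_def)
    then show ?thesis using that by (simp add: field_simps)
  qed
  define L where "L = N + \<tau>2 \<bar>r\<bar> / s0"
  have L: "L \<ge> N" "L \<ge> \<tau>2 \<bar>r\<bar> / s0" "L \<ge> 0" using nonneg[of "\<bar>r\<bar>"] s0 N by (auto simp: L_def)
  have zero: "\<tau>2 0 \<le> 0"
  proof (rule ccontr)
    assume neg: "\<not> \<tau>2 0 \<le> 0"
    define s where "s = min (s0 / 2) (\<tau>2 0 / (2 * (N + 1)))"
    have "0 < \<tau>2 0 / (2 * (N + 1))" using neg N by (intro divide_pos_pos) auto
    then have s: "0 < s" "s < s0" using s0 by (auto simp: s_def)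
    have "\<tau>2 0 \<le> N * s" using near[OF s] mono[of 0 s] s by linarith
    also have "\<dots> \<le> (N + 1) * (\<tau>2 0 / (2 * (N + 1)))"
      using s N by (intro mult_mono) (auto simp: s_def)
    also have "\<dots> = \<tau>2 0 / 2" using N by (simp add: field_simps)
    finally show False using neg by simp
  qed
  have "\<tau>2 s \<le> L * s" if s: "0 \<le> s" "s \<le> r" for s
  proof (cases "s = 0 \<or> s < s0")
    case True
    have "N * s \<le> L * s" using L s by (intro mult_right_mono) auto
    moreover have "\<tau>2 s \<le> N * s" using near[of s] True zero s by (cases "s = 0") auto
    ultimately show ?thesis by linarith
  next
    case False
    have "\<tau>2 s \<le> \<tau>2 \<bar>r\<bar> / s0 * s0" using mono[of s "\<bar>r\<bar>"] s s0 by simp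
    also have "\<dots> \<le> L * s" using False L s0 nonneg[of "\<bar>r\<bar>"] by (intro mult_mono) auto
    finally show ?thesis .
  qed
  then show ?thesis using L by auto
qed

section \<open>The set of gains\<close>

text \<open>
  An open tube around the ray \<open>k\<^sub>j = c\<^sub>j t\<close>, \<open>t > \<kappa>\<close>, where \<open>c\<^sub>j\<close> are the coefficients of \<open>(s + 2)\<^sup>n\<close>.
\<close>

definition gain_tube :: "real \<Rightarrow> (real \<times> ('n::{finite,linorder}) vect) set" where
  "gain_tube \<kappa> = {k. \<kappa> < gain k CARD('n) \<and>
     (\<forall>j<CARD('n). \<bar>gain k j - filter_coeff CARD('n) j * gain k CARD('n)\<bar> < 1)}"

lemma continuous_on_gain [continuous_intros]: "continuous_on S (\<lambda>k. gain k j)"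
  by (cases j) (auto simp: gain_def intro!: continuous_intros)

lemma open_gain_tube: "open (gain_tube \<kappa> :: (real \<times> ('n::{finite,linorder}) vect) set)"
proof -
  have "gain_tube \<kappa> = {k :: real \<times> 'n vect. \<kappa> < gain k CARD('n)} \<inter>
     (\<Inter>j\<in>{..<CARD('n)}. {k. \<bar>gain k j - filter_coeff CARD('n) j * gain k CARD('n)\<bar> < 1})"
    by (auto simp: gain_tube_def)
  moreover have "open {k :: real \<times> 'n vect. \<kappa> < gain k CARD('n)}"
    by (intro open_Collect_less continuous_intros)
  moreover have "open {k :: real \<times> 'n vect. \<bar>gain k j - filter_coeff CARD('n) j * gain k CARD('n)\<bar> < 1}" for j
    by (intro open_Collect_less continuous_intros)
  ultimately show ?thesis by (auto intro!: open_Int open_INT)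
qed

lemma filter_coeff_self [simp]: "filter_coeff n n = 1"
  by (simp add: filter_coeff_def)

lemma unbounded_gain_tube: "\<not> bounded (gain_tube \<kappa> :: (real \<times> ('n::{finite,linorder}) vect) set)"
proof
  assume "bounded (gain_tube \<kappa> :: (real \<times> 'n vect) set)"
  then obtain B where B: "\<And>k :: real \<times> 'n vect. k \<in> gain_tube \<kappa> \<Longrightarrow> norm k \<le> B" by (auto simp: bounded_iff)
  define t where "t = \<bar>\<kappa>\<bar> + \<bar>B\<bar> + 1"
  define k :: "real \<times> 'n vect" where
    "k = (filter_coeff CARD('n) 0 * t, \<chi> i. filter_coeff CARD('n) (Suc (pos i)) * t)"
  have gain: "gain k j = filter_coeff CARD('n) j * t" if "j \<le> CARD('n)" for j
    using that by (cases j) (auto simp: gain_def k_def pos_coord)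
  then have "k \<in> gain_tube \<kappa>" by (auto simp: gain_tube_def t_def)
  then have "norm k \<le> B" by (rule B)
  moreover have "t = fst k / filter_coeff CARD('n) 0" by (simp add: k_def filter_coeff_def)
  then have "\<bar>t\<bar> \<le> norm k"
  proof -
    have "\<bar>t\<bar> * 1 \<le> \<bar>t\<bar> * 2 ^ CARD('n)" by (intro mult_left_mono) auto
    also have "\<dots> = norm (fst k)" by (simp add: k_def filter_coeff_def abs_mult mult.commute)
    also have "\<dots> \<le> norm k" using norm_fst_le[of "fst k" "snd k"] by simp
    finally show ?thesis by simp
  qed
  ultimately show False by (simp add: t_def)
qed

lemma gain_threshold_ge_1: "b > 0 \<Longrightarrow> 1 \<le> gain_threshold n b L \<Gamma>"
  by (simp add: gain_threshold_def)

text \<open>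
  The initial error of the integrator is \<open>q*\<close>, which is inversely proportional to \<open>k\<^sub>0\<close>; this bound
  makes its size independent of the gains.
\<close>

lemma integral_gain_ge_1:
  assumes "k \<in> gain_tube \<kappa>" "1 \<le> \<kappa>"
  shows "1 \<le> gain (k :: real \<times> ('n::{finite,linorder}) vect) 0"
proof -
  have "\<bar>gain k 0 - filter_coeff CARD('n) 0 * gain k CARD('n)\<bar> < 1" "1 < gain k CARD('n)"
    using assms by (auto simp: gain_tube_def)
  then have "\<bar>gain k 0 - 2 ^ CARD('n) * gain k CARD('n)\<bar> < 1" "1 < gain k CARD('n)"
    by (auto simp: filter_coeff_def)
  moreover have "2 ^ 1 \<le> (2 ^ CARD('n) :: real)"
    by (rule power_increasing) (auto simp: Suc_le_eq)
  then have "2 * 1 \<le> 2 ^ CARD('n) * gain k CARD('n)"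
    using \<open>1 < gain k CARD('n)\<close> by (intro mult_mono) auto
  ultimately show ?thesis by linarith
qed

section \<open>Closed loop in error coordinates\<close>

text \<open>
  The parameter \<open>qs\<close> is the equilibrium value \<open>q*\<close> of the integrator state.
\<close>

definition chain_error :: "real \<Rightarrow> (('n::{finite,linorder}) vect \<Rightarrow> 'n vect) \<Rightarrow> ('n vect \<Rightarrow> real)
    \<Rightarrow> real \<Rightarrow> real \<Rightarrow> 'n vect \<Rightarrow> nat \<Rightarrow> real" where
  "chain_error ystar f h qs q x i =
     (case i of 0 \<Rightarrow> qs - q | Suc m \<Rightarrow> lie_iter f m h x - (if m = 0 then ystar else 0))"

lemma Phi_minus_zstar_nth: "(Phi f h x - zstar ystar) $ i = chain_error ystar f h qs q x (Suc (pos i))"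
  by (simp add: Phi_def zstar_def chain_error_def)

lemma norm_Phi_minus_zstar_le:
  fixes x :: "('n::{finite,linorder}) vect"
  assumes "\<And>i. i \<le> CARD('n) \<Longrightarrow> \<bar>chain_error ystar f h qs q x i\<bar> \<le> m"
  shows "norm (Phi f h x - zstar ystar) \<le> real CARD('n) * m"
proof -
  have "norm (Phi f h x - zstar ystar) \<le> (\<Sum>i\<in>UNIV. \<bar>(Phi f h x - zstar ystar) $ i\<bar>)"
    by (rule norm_le_l1_cart)
  also have "\<dots> \<le> (\<Sum>i\<in>(UNIV::'n set). m)"
    unfolding Phi_minus_zstar_nth[where qs = qs and q = q]
    by (intro sum_mono assms) (simp add: Suc_le_eq pos_less_card)
  finally show ?thesis by simp
qed

lemma chain_error_le_norm:
  fixes x :: "('n::{finite,linorder}) vect"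
  assumes "m < CARD('n)"
  shows "\<bar>chain_error ystar f h qs q x (Suc m)\<bar> \<le> norm (Phi f h x - zstar ystar)"
  using component_le_norm_cart[of "Phi f h x - zstar ystar" "coord m"] assms
  unfolding Phi_minus_zstar_nth[where qs = qs and q = q] by (simp add: pos_coord)

lemma pid_control_eq_chain_error:
  fixes x :: "('n::{finite,linorder}) vect"
  shows "pid_control ystar f h k q x
       = gain k 0 * qs - (\<Sum>j\<le>CARD('n). gain k j * chain_error ystar f h qs q x j)"
proof -
  let ?a = "\<lambda>j. gain k j * chain_error ystar f h qs q x j"
  have "{..CARD('n)} = {0, 1} \<union> {2..CARD('n)}" by (auto simp: Suc_le_eq)
  then have "sum ?a {..CARD('n)} = sum ?a {0, 1} + sum ?a {2..CARD('n)}"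
    by (simp add: sum.union_disjoint)
  also have "sum ?a {2..CARD('n)} = (\<Sum>j=2..CARD('n). gain k j * lie_iter f (j - 1) h x)"
    by (intro sum.cong) (auto simp: chain_error_def split: nat.split)
  finally show ?thesis
    by (simp add: pid_control_def chain_error_def lie_iter_def algebra_simps)
qed

definition solves_on ::
  "real \<Rightarrow> (('n::{finite,linorder}) vect \<Rightarrow> 'n vect) \<Rightarrow> ('n vect \<Rightarrow> 'n vect) \<Rightarrow> ('n vect \<Rightarrow> real)
    \<Rightarrow> real \<times> 'n vect \<Rightarrow> real set \<Rightarrow> (real \<Rightarrow> 'n vect) \<Rightarrow> (real \<Rightarrow> real) \<Rightarrow> bool" where
  "solves_on ystar f g h k S x q \<longleftrightarrow> (\<forall>t\<in>S.
     (x has_vector_derivative (f (x t) + pid_control ystar f h k (q t) (x t) *\<^sub>R g (x t))) (at t within S) \<and>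
     (q has_real_derivative (ystar - h (x t))) (at t within S))"

text \<open>
  The second conjunct bounds the derivative of the last error, so that together with the first one the
  whole velocity of \<open>\<Phi>(x)\<close> decays. Solutions on compact intervals are used in order to have a priori
  bounds before global existence is known.
\<close>

definition errors_decay ::
  "real \<Rightarrow> (('n::{finite,linorder}) vect \<Rightarrow> 'n vect) \<Rightarrow> ('n vect \<Rightarrow> 'n vect) \<Rightarrow> ('n vect \<Rightarrow> real)
    \<Rightarrow> real \<times> 'n vect \<Rightarrow> real \<Rightarrow> real \<Rightarrow> real \<Rightarrow> bool" where
  "errors_decay ystar f g h k R qs C \<longleftrightarrow>
    (\<forall>x q T t. norm (x 0) \<le> R \<longrightarrow> q 0 = 0 \<longrightarrow> solves_on ystar f g h k {0..T} x q \<longrightarrow>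
     t \<in> {0..T} \<longrightarrow>
       (\<forall>i\<le>CARD('n). \<bar>chain_error ystar f h qs (q t) (x t) i\<bar> \<le> C * exp (- t / 2)) \<and>
       \<bar>drift f h (x t) + input_gain f g h (x t) * pid_control ystar f h k (q t) (x t)\<bar> \<le> C * exp (- t / 2))"

lemma closed_loop_solution_iff:
  "closed_loop_solution ystar f g h k xi x q \<longleftrightarrow>
     x 0 = xi \<and> q 0 = 0 \<and> solves_on ystar f g h k {0..} x q"
  by (auto simp: closed_loop_solution_def solves_on_def)

lemma solves_on_subset:
  "solves_on ystar f g h k S x q \<Longrightarrow> T \<subseteq> S \<Longrightarrow> solves_on ystar f g h k T x q"
  unfolding solves_on_def
  by (meson DERIV_subset has_vector_derivative_within_subset subsetD)

context affine_system
begin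

lemma smooth_along_trajectory:
  assumes x: "(x has_vector_derivative (f (x t) + u *\<^sub>R g (x t))) (at t within S)" and "smooth \<phi>"
  shows "((\<lambda>s. \<phi> (x s)) has_real_derivative (lie_deriv f \<phi> (x t) + u * lie_deriv g \<phi> (x t))) (at t within S)"
proof -
  let ?D = "frechet_derivative \<phi> (at (x t))"
  have "((\<lambda>s. \<phi> (x s)) has_derivative (\<lambda>r. ?D (r *\<^sub>R (f (x t) + u *\<^sub>R g (x t))))) (at t within S)"
    using has_derivative_compose[OF x[unfolded has_vector_derivative_def] smooth_has_derivative[OF assms(2)]] .
  moreover have "?D (r *\<^sub>R (f (x t) + u *\<^sub>R g (x t))) = (lie_deriv f \<phi> (x t) + u * lie_deriv g \<phi> (x t)) * r" for r
    using has_derivative_linear[OF smooth_has_derivative[OF assms(2), of "x t"]]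
    by (simp add: lie_deriv_eq_derivative[OF assms(2)] linear_add linear_cmul algebra_simps)
  ultimately show ?thesis by (simp add: has_field_derivative_def)
qed

lemma chain_error_derivative:
  assumes "solves_on ystar f g h k S x q" "t \<in> S" "i < CARD('n)"
  shows "((\<lambda>s. chain_error ystar f h qs (q s) (x s) i) has_real_derivative
      chain_error ystar f h qs (q t) (x t) (Suc i)) (at t within S)"
proof (cases i)
  case 0
  have "(q has_real_derivative (ystar - h (x t))) (at t within S)"
    using assms by (simp add: solves_on_def)
  then show ?thesis
    unfolding 0 by (auto simp: chain_error_def lie_iter_def intro!: derivative_eq_intros)
next
  case (Suc m)
  have "lie_deriv g (lie_iter f m h) (x t) = 0"
    using Suc assms by (intro lie_deriv_input_eq_0) simp
  then have "((\<lambda>s. lie_iter f m h (x s)) has_real_derivative lie_iter f (Suc m) h (x t)) (at t within S)"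
    using smooth_along_trajectory[OF _ smooth_output[of m]] assms
    by (fastforce simp: solves_on_def lie_iter_Suc)
  then show ?thesis
    unfolding Suc by (auto simp: chain_error_def intro!: derivative_eq_intros)
qed

text \<open>
  The input appears for the first time in the last component: this is the relative degree \<open>n\<close>.
\<close>

lemma last_chain_error_derivative:
  assumes "solves_on ystar f g h k S x q" "t \<in> S"
  shows "((\<lambda>s. chain_error ystar f h qs (q s) (x s) CARD('n)) has_real_derivative
      (drift f h (x t) + input_gain f g h (x t) * pid_control ystar f h k (q t) (x t))) (at t within S)"
proof -
  obtain m where n: "CARD('n) = Suc m" using not0_implies_Suc[of "CARD('n)"] by auto
  have "((\<lambda>s. lie_iter f m h (x s)) has_real_derivative
      (drift f h (x t) + pid_control ystar f h k (q t) (x t) * input_gain f g h (x t))) (at t within S)"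
    using smooth_along_trajectory[OF _ smooth_output[of m]] assms
    unfolding solves_on_def drift_def input_gain_def n lie_iter_Suc by simp
  then show ?thesis
    unfolding n by (auto simp: chain_error_def mult.commute intro!: derivative_eq_intros)
qed

text \<open>
  The closed loop meets the hypotheses of \<open>integrator_chain_decay\<close>: \<open>\<rho>\<close> bounds the initial errors,
  \<open>\<Gamma>\<close> bounds the input gain within the trapping radius, and the perturbation has the slope
  \<open>(1 + \<mu> / b) L2 n\<close>, where \<open>\<mu> / b\<close> bounds the equilibrium input \<open>F(x*) / G(x*)\<close> and \<open>n\<close> comes from
  passing between the Euclidean norm and the maximum of the components. All these constants are
  expressed by the known data; only \<open>qs\<close> and \<open>C\<close> depend on the system.
\<close>

lemma chain_error_decay:
  assumes adm: "admissible_data b \<tau>1 \<tau>2" and growth: "growth_bounds ystar \<tau>1 \<tau>2 f g h" and R: "R \<ge> 0"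
  defines "\<mu> \<equiv> \<tau>1 (norm (zstar ystar :: 'n vect))"
  defines "\<rho> \<equiv> \<mu> / b + \<tau>1 R + norm (zstar ystar :: 'n vect)"
  defines "r \<equiv> trapping_radius CARD('n) \<rho>"
  defines "\<Gamma> \<equiv> \<tau>1 (norm (zstar ystar :: 'n vect) + real CARD('n) * r)"
  assumes L2: "L2 \<ge> 0" "\<And>s. 0 \<le> s \<Longrightarrow> s \<le> real CARD('n) * r \<Longrightarrow> \<tau>2 s \<le> L2 * s"
    and k: "k \<in> gain_tube (gain_threshold CARD('n) b ((1 + \<mu> / b) * (L2 * real CARD('n))) \<Gamma>)"
  shows "\<exists>qs C. C > 0 \<and> errors_decay ystar f g h k R qs C"
proof -
  let ?n = "CARD('n)"
  define L where "L = (1 + \<mu> / b) * (L2 * real ?n)"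
  have b: "b > 0" using adm by (simp add: admissible_data_def)
  have mono1: "\<tau>1 s \<le> \<tau>1 s'" if "0 \<le> s" "s \<le> s'" for s s'
    using adm that unfolding admissible_data_def mono_on_def by auto
  have nonneg1: "0 \<le> \<tau>1 s" if "0 \<le> s" for s using adm that by (simp add: admissible_data_def)
  have \<mu>: "\<mu> \<ge> 0" by (simp add: \<mu>_def nonneg1)
  have k0: "gain k 0 \<ge> 1"
    using integral_gain_ge_1[OF k gain_threshold_ge_1[OF b]] .
  obtain xs where xs: "Phi f h xs = zstar ystar"
    "\<And>x. norm (FG f g h x - FG f g h xs) \<le> \<tau>2 (norm (Phi f h x - zstar ystar))"
    using growth unfolding growth_bounds_def by metis
  have bound1: "norm (Phi f h x) \<le> \<tau>1 (norm x)" "norm (FG f g h x) \<le> \<tau>1 (norm (Phi f h x))" for x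
    using growth unfolding growth_bounds_def by auto
  define Fs where "Fs = drift f h xs"
  define Gs where "Gs = input_gain f g h xs"
  define qs where "qs = - Fs / (gain k 0 * Gs)"
  have Gs: "Gs \<ge> b" "Gs > 0" using input_gain_ge[of xs] b by (auto simp: Gs_def)
  have "\<bar>Fs\<bar> \<le> \<mu>"
    using norm_fst_le[of Fs Gs] bound1(2)[of xs] by (simp add: Fs_def Gs_def \<mu>_def xs FG_def)
  then have ratio: "\<bar>Fs / Gs\<bar> \<le> \<mu> / b"
    using Gs b \<mu> by (simp add: frac_le)
  have qs: "\<bar>qs\<bar> \<le> \<mu> / b"
  proof -
    have "\<bar>qs\<bar> = \<bar>Fs / Gs\<bar> / gain k 0" using k0 Gs by (simp add: qs_def abs_mult)
    also have "\<dots> \<le> \<bar>Fs / Gs\<bar> / 1" using k0 by (intro divide_left_mono) auto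
    finally show ?thesis using ratio by simp
  qed
  have "\<rho> \<ge> 0" using \<mu> b R nonneg1 by (simp add: \<rho>_def)
  then have r: "r \<ge> 0" by (simp add: r_def trapping_radius_def)
  define \<Delta> where "\<Delta> x = drift f h x + input_gain f g h x * (gain k 0 * qs)" for x
  have region: "\<bar>\<Delta> x\<bar> \<le> L * m \<and> b \<le> input_gain f g h x \<and> input_gain f g h x \<le> \<Gamma>"
    if m: "m \<le> r" "\<And>i. i \<le> ?n \<Longrightarrow> \<bar>chain_error ystar f h qs p x i\<bar> \<le> m" for m p x
  proof -
    have m0: "m \<ge> 0" using m(2)[of 0] by linarith
    define d where "d = norm (Phi f h x - zstar ystar)"
    have d: "d \<le> real ?n * m" unfolding d_def using m(2) by (rule norm_Phi_minus_zstar_le)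
    then have d': "d \<le> real ?n * r" using mult_left_mono[OF m(1), of "real ?n"] by linarith
    have "norm (Phi f h x) \<le> norm (zstar ystar :: 'n vect) + real ?n * r"
      using d' norm_triangle_sub[of "Phi f h x" "zstar ystar"] by (simp add: d_def)
    then have "norm (FG f g h x) \<le> \<Gamma>"
      unfolding \<Gamma>_def using bound1(2)[of x] mono1[of "norm (Phi f h x)"] by fastforce
    then have G: "input_gain f g h x \<le> \<Gamma>"
      using norm_snd_le[of "input_gain f g h x" "drift f h x"] by (simp add: FG_def)
    define D where "D = FG f g h x - FG f g h xs"
    have "norm D \<le> L2 * d"
      using xs(2)[of x] L2(2)[of d] d' by (simp add: D_def d_def)
    also have "\<dots> \<le> L2 * (real ?n * m)" using d L2 by (intro mult_left_mono)
    finally have D: "norm D \<le> L2 * real ?n * m" by simp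
    \<comment> \<open>\<open>\<Delta>\<close> vanishes at \<open>xs\<close>, so it is linear in the deviation of the pair \<open>(F, G)\<close>\<close>
    have ss: "gain k 0 * qs = - (Fs / Gs)" "Gs * (Fs / Gs) = Fs" using k0 Gs by (auto simp: qs_def)
    have "fst D = drift f h x - Fs" "snd D = input_gain f g h x - Gs"
      by (simp_all add: D_def FG_def Fs_def Gs_def)
    then have "\<Delta> x = fst D - snd D * (Fs / Gs)"
      unfolding \<Delta>_def ss(1) using Gs by (simp add: left_diff_distrib diff_divide_distrib)
    then have "\<bar>\<Delta> x\<bar> \<le> \<bar>fst D\<bar> + \<bar>snd D\<bar> * \<bar>Fs / Gs\<bar>"
      by (metis abs_mult abs_triangle_ineq4)
    also have "\<dots> \<le> norm D + norm D * (\<mu> / b)"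
      using norm_fst_le[of "fst D" "snd D"] norm_snd_le[of "snd D" "fst D"] ratio by (intro add_mono mult_mono) auto
    also have "\<dots> = (1 + \<mu> / b) * norm D" by (simp add: algebra_simps)
    also have "\<dots> \<le> (1 + \<mu> / b) * (L2 * real ?n * m)"
      using D \<mu> b by (intro mult_left_mono) auto
    finally show ?thesis using G input_gain_ge by (simp add: L_def mult.assoc)
  qed
  have control: "drift f h x + input_gain f g h x * pid_control ystar f h k p x
      = \<Delta> x - input_gain f g h x * (\<Sum>j\<le>?n. gain k j * chain_error ystar f h qs p x j)" for x p
    by (simp add: pid_control_eq_chain_error[of _ _ _ _ _ _ qs] \<Delta>_def algebra_simps)
  define K where "K = (\<Sum>j\<le>?n. \<bar>gain k j\<bar>)"
  define C where "C = (r + (L * r + \<Gamma> * (K * r))) + 1"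
  have \<Gamma>: "\<Gamma> \<ge> 0" using r by (simp add: \<Gamma>_def nonneg1)
  have "K \<ge> 0" by (simp add: K_def sum_nonneg)
  moreover have "L \<ge> 0" using \<mu> b L2 by (simp add: L_def)
  ultimately have C: "r \<le> C" "L * r + \<Gamma> * (K * r) \<le> C" "C > 0"
    using r \<Gamma> by (auto simp: C_def add_nonneg_pos)
  have main: "(\<forall>i\<le>?n. \<bar>chain_error ystar f h qs (q t) (x t) i\<bar> \<le> C * exp (- t / 2)) \<and>
       \<bar>drift f h (x t) + input_gain f g h (x t) * pid_control ystar f h k (q t) (x t)\<bar> \<le> C * exp (- t / 2)"
    if init: "norm (x 0) \<le> R" "q 0 = 0" and sol: "solves_on ystar f g h k {0..T} x q" and t: "t \<in> {0..T}"
    for x q T t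
  proof -
    have init': "\<bar>chain_error ystar f h qs (q 0) (x 0) i\<bar> \<le> \<rho>" if i: "i \<le> ?n" for i
    proof (cases i)
      case 0
      then show ?thesis
        using qs init nonneg1[OF R] norm_ge_zero[of "zstar ystar :: 'n vect"]
        by (simp add: chain_error_def \<rho>_def del: norm_ge_zero)
    next
      case (Suc m)
      have "\<bar>chain_error ystar f h qs (q 0) (x 0) i\<bar> \<le> norm (Phi f h (x 0) - zstar ystar)"
        unfolding Suc using i Suc by (intro chain_error_le_norm) simp
      also have "\<dots> \<le> \<tau>1 R + norm (zstar ystar :: 'n vect)"
        using norm_triangle_ineq4[of "Phi f h (x 0)" "zstar ystar"] bound1(1)[of "x 0"]
          mono1[OF norm_ge_zero init(1)] by linarith
      finally show ?thesis using \<mu> b divide_nonneg_pos[of \<mu> b] unfolding \<rho>_def by linarith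
    qed
    define E where "E = exp (- t / 2)"
    have E: "0 \<le> E" "E \<le> 1" using t by (auto simp: E_def)
    have decay: "\<bar>chain_error ystar f h qs (q t) (x t) i\<bar> \<le> r * E" if "i \<le> ?n" for i
      unfolding r_def E_def
    proof (rule integrator_chain_decay[where \<zeta> = "\<lambda>t. chain_error ystar f h qs (q t) (x t)"
          and \<Delta> = "\<lambda>t. \<Delta> (x t)" and G = "\<lambda>t. input_gain f g h (x t)" and k = "gain k", OF b])
      show "((\<lambda>s. chain_error ystar f h qs (q s) (x s) ?n) has_real_derivative
         \<Delta> (x s) - input_gain f g h (x s) * (\<Sum>j\<le>?n. gain k j * chain_error ystar f h qs (q s) (x s) j))
         (at s within {0..T})" if "s \<in> {0..T}" for s
        using last_chain_error_derivative[OF sol that] by (simp add: control)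
      show "\<bar>\<Delta> (x s)\<bar> \<le> L * m \<and> b \<le> input_gain f g h (x s) \<and> input_gain f g h (x s) \<le> \<Gamma>"
        if "m \<le> trapping_radius ?n \<rho>" "\<And>i. i \<le> ?n \<Longrightarrow> \<bar>chain_error ystar f h qs (q s) (x s) i\<bar> \<le> m" for s m
        using that by (intro region) (auto simp: r_def)
    qed (use k chain_error_derivative[OF sol] init' t that in \<open>auto simp: gain_tube_def L_def less_imp_le\<close>)
    have "r * E \<le> r" using E r mult_left_le by blast
    from region[OF this decay]
    have reg: "\<bar>\<Delta> (x t)\<bar> \<le> L * (r * E)" "0 \<le> input_gain f g h (x t)" "input_gain f g h (x t) \<le> \<Gamma>"
      using b by auto
    have "\<bar>\<Sum>j\<le>?n. gain k j * chain_error ystar f h qs (q t) (x t) j\<bar> \<le> (\<Sum>j\<le>?n. \<bar>gain k j\<bar> * (r * E))"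
      using decay by (intro order_trans[OF sum_abs] sum_mono) (simp add: abs_mult mult_left_mono)
    also have "\<dots> = K * (r * E)" by (simp add: K_def sum_distrib_right)
    finally have "\<bar>input_gain f g h (x t) * (\<Sum>j\<le>?n. gain k j * chain_error ystar f h qs (q t) (x t) j)\<bar>
        \<le> \<Gamma> * (K * (r * E))"
      using reg \<Gamma> unfolding abs_mult by (intro mult_mono) auto
    then have "\<bar>drift f h (x t) + input_gain f g h (x t) * pid_control ystar f h k (q t) (x t)\<bar>
        \<le> (L * r + \<Gamma> * (K * r)) * E"
      using reg(1) unfolding control by (simp add: algebra_simps)
    moreover have "(L * r + \<Gamma> * (K * r)) * E \<le> C * E" "r * E \<le> C * E"
      using C E by (auto intro: mult_right_mono)
    ultimately show ?thesis using decay unfolding E_def by (meson order_trans)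
  qed
  show ?thesis
    unfolding errors_decay_def by (rule exI[of _ qs], rule exI[of _ C]) (use C main in blast)
qed

end

lemma admissible_gains:
  fixes \<tau>1 \<tau>2 :: "real \<Rightarrow> real"
  assumes adm: "admissible_data b \<tau>1 \<tau>2" and R: "R > 0"
  obtains \<Omega> :: "(real \<times> ('n::{finite,linorder}) vect) set"
  where "open \<Omega>" "\<not> bounded \<Omega>"
    "\<forall>f g h. affine_system f g h b \<longrightarrow> growth_bounds ystar \<tau>1 \<tau>2 f g h \<longrightarrow>
       (\<forall>k\<in>\<Omega>. \<exists>qs C. C > 0 \<and> errors_decay ystar f g h k R qs C)"
proof -
  define \<mu> where "\<mu> = \<tau>1 (norm (zstar ystar :: 'n vect))"
  define r where "r = trapping_radius CARD('n) (\<mu> / b + \<tau>1 R + norm (zstar ystar :: 'n vect))"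
  obtain L2 where L2: "L2 \<ge> 0" "\<And>s. 0 \<le> s \<Longrightarrow> s \<le> real CARD('n) * r \<Longrightarrow> \<tau>2 s \<le> L2 * s"
    using tau2_linear_bound[OF adm, of "real CARD('n) * r"] by blast
  define \<kappa> where "\<kappa> = gain_threshold CARD('n) b ((1 + \<mu> / b) * (L2 * real CARD('n)))
    (\<tau>1 (norm (zstar ystar :: 'n vect) + real CARD('n) * r))"
  have "\<exists>qs C. C > 0 \<and> errors_decay ystar f g h k R qs C"
    if "affine_system f g h b" "growth_bounds ystar \<tau>1 \<tau>2 f g h" "k \<in> gain_tube \<kappa>"
    for f g :: "'n vect \<Rightarrow> 'n vect" and h k
    using affine_system.chain_error_decay[OF that(1) adm that(2) less_imp_le[OF R] L2[unfolded r_def \<mu>_def]] that(3)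
    by (simp add: \<kappa>_def r_def \<mu>_def)
  then show thesis by (intro that[OF open_gain_tube unbounded_gain_tube]) blast
qed

section \<open>Boundedness of the state and existence of solutions\<close>

text \<open>
  With \<open>p = 3 + \<bar>x\<bar>\<^sup>2\<close> the growth bound gives \<open>p' \<le> A exp (- t / 2) p log p\<close>, that is,
  \<open>(log log p)' \<le> A exp (- t / 2)\<close>, and the right-hand side has integral at most \<open>2 A\<close>. The constant
  3 exceeds \<open>e\<close>, so that \<open>log p \<ge> 1\<close>.
\<close>

lemma norm_bound_of_log_growth:
  fixes x :: "real \<Rightarrow> 'a::euclidean_space"
  assumes der: "\<And>t. t \<in> {0..T} \<Longrightarrow> (x has_vector_derivative x' t) (at t within {0..T})"
    and growth: "\<And>t. t \<in> {0..T} \<Longrightarrow>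
      norm (x' t) \<le> (N1 * norm (x t) * ln (norm (x t)) + N2) * (K * exp (- t / 2))"
    and nonneg: "N1 \<ge> 0" "N2 \<ge> 0" "K \<ge> 0" and init: "norm (x 0) \<le> R" and T: "T \<ge> 0"
  shows "norm (x T) \<le> exp (exp (ln (ln (3 + R\<^sup>2)) + 2 * ((N1 + N2) * K)))"
proof -
  define A where "A = (N1 + N2) * K"
  define p where "p t = 3 + x t \<bullet> x t" for t
  define p' where "p' t = 2 * (x t \<bullet> x' t)" for t
  have sq: "x t \<bullet> x t = (norm (x t))\<^sup>2" for t by (simp add: dot_square_norm)
  have ln1: "1 \<le> ln s" if "s \<ge> 3" for s :: real
    using that exp_le by (subst ln_ge_iff) auto
  have p3: "p t \<ge> 3" for t by (simp add: p_def)
  have p0: "p t > 0" for t using p3[of t] by linarith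
  have lnp: "1 \<le> ln (p t)" for t by (rule ln1[OF p3])
  have p_der: "(p has_real_derivative p' t) (at t within {0..T})" if "t \<in> {0..T}" for t
  proof -
    have "((\<lambda>t. x t \<bullet> x t) has_derivative (\<lambda>s. x t \<bullet> (s *\<^sub>R x' t) + (s *\<^sub>R x' t) \<bullet> x t)) (at t within {0..T})"
      by (intro has_derivative_inner der[OF that, unfolded has_vector_derivative_def])
    moreover have "(\<lambda>s. x t \<bullet> (s *\<^sub>R x' t) + (s *\<^sub>R x' t) \<bullet> x t) = (*) (p' t)"
      by (auto simp: p'_def inner_commute fun_eq_iff)
    ultimately have "((\<lambda>t. x t \<bullet> x t) has_real_derivative p' t) (at t within {0..T})"
      by (simp only: has_field_derivative_def)
    then show ?thesis
      unfolding p_def[abs_def] by (auto intro!: derivative_eq_intros)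
  qed
  have p'_le: "p' t \<le> p t * ln (p t) * (A * exp (- t / 2))" if t: "t \<in> {0..T}" for t
  proof -
    define a where "a = norm (x t)"
    define E where "E = K * exp (- t / 2)"
    have E: "E \<ge> 0" using nonneg by (simp add: E_def)
    have a0: "a \<ge> 0" by (simp add: a_def)
    have pa: "p t = 3 + a\<^sup>2" by (simp add: p_def a_def dot_square_norm)
    have pp: "p t \<le> p t * ln (p t)" using mult_left_mono[OF lnp[of t], of "p t"] p0[of t] by simp
    have 1: "2 * a * (a * ln a) \<le> p t * ln (p t)"
    proof (cases "a \<ge> 1")
      case True
      have "2 * a * (a * ln a) = a\<^sup>2 * ln (a\<^sup>2)"
        using True by (simp add: ln_realpow) (simp add: power2_eq_square)
      also have "\<dots> \<le> p t * ln (p t)"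
        using True p3[of t] by (intro mult_mono ln_mono) (auto simp: pa)
      finally show ?thesis .
    next
      case False
      have "ln a \<le> 0"
      proof (cases "a = 0")
        case False
        then show ?thesis using \<open>\<not> 1 \<le> a\<close> a0 by simp
      qed simp
      then have "2 * a * (a * ln a) \<le> 0" using a0 by (simp add: mult_nonneg_nonpos)
      then show ?thesis using pp p0[of t] by linarith
    qed
    have 2: "2 * a \<le> p t * ln (p t)"
    proof -
      have "0 \<le> (a - 1)\<^sup>2" by simp
      then have "2 * a \<le> p t" by (simp add: pa power2_diff)
      then show ?thesis using pp by linarith
    qed
    have "p' t \<le> 2 * (a * norm (x' t))"
      unfolding p'_def a_def using norm_cauchy_schwarz[of "x t" "x' t"] by simp
    also have "\<dots> \<le> 2 * (a * ((N1 * a * ln a + N2) * E))"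
      using growth[OF t] a0 by (intro mult_left_mono) (auto simp: a_def E_def)
    also have "\<dots> = (N1 * (2 * a * (a * ln a)) + N2 * (2 * a)) * E" by (simp add: algebra_simps)
    also have "\<dots> \<le> (N1 * (p t * ln (p t)) + N2 * (p t * ln (p t))) * E"
      using 1 2 nonneg E by (intro mult_right_mono add_mono mult_left_mono)
    finally show ?thesis by (simp add: A_def E_def algebra_simps)
  qed
  \<comment> \<open>the primitive of \<open>A exp (- t / 2)\<close> is absorbed, so \<open>w\<close> is nonincreasing\<close>
  define w where "w t = ln (ln (p t)) + 2 * A * exp (- t / 2)" for t
  have "w T \<le> w 0"
  proof (rule nonincreasing_of_derivative_nonpos[OF _ _ T])
    fix t assume t: "t \<in> {0..T}"
    have lp: "ln (p t) > 0" using lnp[of t] by linarith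
    show "(w has_real_derivative p' t / (p t * ln (p t)) - A * exp (- t / 2)) (at t within {0..T})"
      unfolding w_def[abs_def] using p0[of t] lp
      by (auto intro!: derivative_eq_intros p_der[OF t] simp: field_simps)
    have "p' t / (p t * ln (p t)) \<le> A * exp (- t / 2)"
      using p'_le[OF t] p0[of t] lp by (simp add: pos_divide_le_eq mult_ac)
    then show "p' t / (p t * ln (p t)) - A * exp (- t / 2) \<le> 0" by simp
  qed
  moreover have "0 \<le> 2 * A * exp (- T / 2)" using nonneg by (simp add: A_def)
  ultimately have "ln (ln (p T)) \<le> ln (ln (p 0)) + 2 * A" by (simp add: w_def)
  moreover have "ln (ln (p 0)) \<le> ln (ln (3 + R\<^sup>2))"
  proof -
    have "p 0 \<le> 3 + R\<^sup>2" using init by (simp add: p_def sq power_mono)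
    then have "ln (p 0) \<le> ln (3 + R\<^sup>2)" using p0[of 0] by (intro ln_mono) auto
    moreover have "0 < ln (p 0)" using lnp[of 0] by linarith
    ultimately show ?thesis by (rule ln_mono)
  qed
  ultimately have "ln (ln (p T)) \<le> ln (ln (3 + R\<^sup>2)) + 2 * A" by linarith
  then have "exp (exp (ln (ln (p T)))) \<le> exp (exp (ln (ln (3 + R\<^sup>2)) + 2 * A))" by simp
  moreover have "exp (exp (ln (ln (p T)))) = p T"
  proof -
    have "0 < ln (p T)" using lnp[of T] by linarith
    then have "exp (ln (ln (p T))) = ln (p T)" by (rule exp_ln)
    then show ?thesis using p0[of T] by (simp only: exp_ln)
  qed
  moreover have "norm (x T) \<le> p T"
  proof -
    have "0 \<le> (norm (x T) - 1)\<^sup>2" by simp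
    then have "2 * norm (x T) \<le> (norm (x T))\<^sup>2 + 1" by (simp add: power2_diff)
    then show ?thesis unfolding p_def sq using norm_ge_zero[of "x T"] by linarith
  qed
  ultimately show ?thesis by (simp add: A_def)
qed

context affine_system
begin

lemma lipschitz_closed_loop_field:
  "\<exists>L. L-lipschitz_on (cball 0 r) (\<lambda>w. (f (fst w) + pid_control ystar f h k (snd w) (fst w) *\<^sub>R g (fst w),
      ystar - h (fst w)))"
proof -
  have comp: "Ck 1 (\<lambda>w :: 'n vect \<times> real. \<phi> (fst w))" if "smooth \<phi>" for \<phi> :: "'n vect \<Rightarrow> 'c::euclidean_space"
    by (rule Ck_comp_linear[OF bounded_linear_fst smooth_imp_Ck[OF that]])
  have proj: "Ck 1 (\<lambda>w :: 'n vect \<times> real. snd w)"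
    by (rule Ck_linear_comp[OF bounded_linear_snd Ck_ident])
  show ?thesis
    unfolding pid_control_def
    by (intro Ck_1_lipschitz_on_cball Ck_Pair Ck_add Ck_diff Ck_scaleR Ck_sum Ck_mult Ck_const proj
        comp smooth_f smooth_g smooth_h smooth_output)
qed

lemma closed_loop_solution_exists:
  assumes apriori: "\<And>x q T. x 0 = xi \<Longrightarrow> q 0 = 0 \<Longrightarrow> 0 \<le> T \<Longrightarrow>
      solves_on ystar f g h k {0..T} x q \<Longrightarrow> norm (x T) \<le> M1 \<and> \<bar>q T\<bar> \<le> M2"
  shows "\<exists>x q. closed_loop_solution ystar f g h k xi x q"
proof -
  let ?V = "\<lambda>w. (f (fst w) + pid_control ystar f h k (snd w) (fst w) *\<^sub>R g (fst w), ystar - h (fst w))"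
  have split: "((\<lambda>t. fst (W t)) has_vector_derivative fst w') (at t within S) \<and>
      ((\<lambda>t. snd (W t)) has_real_derivative snd w') (at t within S)"
    if "(W has_vector_derivative w') (at t within S)" for W :: "real \<Rightarrow> 'n vect \<times> real" and w' t S
    using bounded_linear.has_vector_derivative[OF bounded_linear_fst that]
      bounded_linear.has_vector_derivative[OF bounded_linear_snd that]
    by (simp add: has_real_derivative_iff_has_vector_derivative)
  have "\<exists>W. W 0 = (xi, 0) \<and> (\<forall>t\<ge>0. (W has_vector_derivative ?V (W t)) (at t within {0..}))"
  proof (rule ode_global_solution_of_apriori_bound[OF lipschitz_closed_loop_field])
    fix W :: "real \<Rightarrow> 'n vect \<times> real" and T :: real
    assume W: "W 0 = (xi, 0)" "0 \<le> T"
      "\<And>t. t \<in> {0..T} \<Longrightarrow> (W has_vector_derivative ?V (W t)) (at t within {0..T})"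
    have "norm (fst (W T)) \<le> M1 \<and> \<bar>snd (W T)\<bar> \<le> M2"
      using split[OF W(3)] W(1,2)
      by (intro apriori[of "\<lambda>t. fst (W t)" "\<lambda>t. snd (W t)"]) (auto simp: solves_on_def)
    then show "norm (W T) \<le> M1 + M2"
      using norm_Pair_le[of "fst (W T)" "snd (W T)"] by simp
  qed
  then obtain W where W: "W 0 = (xi, 0)" "\<And>t. t \<ge> 0 \<Longrightarrow> (W has_vector_derivative ?V (W t)) (at t within {0..})"
    by blast
  have "closed_loop_solution ystar f g h k xi (\<lambda>t. fst (W t)) (\<lambda>t. snd (W t))"
    using split[OF W(2)] W(1) by (auto simp: closed_loop_solution_def)
  then show ?thesis by blast
qed

text \<open>
  By the chain rule the left-hand side is the velocity of \<open>\<Phi>(x)\<close>. Its components are the errors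
  \<open>\<zeta>\<^sub>2, \<dots>, \<zeta>\<^sub>n\<close> and the derivative of \<open>\<zeta>\<^sub>n\<close>.
\<close>

lemma norm_jacobian_velocity_le:
  assumes sol: "solves_on ystar f g h k S x q" "t \<in> S"
    and err: "\<And>i. i \<le> CARD('n) \<Longrightarrow> \<bar>chain_error ystar f h qs (q t) (x t) i\<bar> \<le> c"
    and last: "\<bar>drift f h (x t) + input_gain f g h (x t) * pid_control ystar f h k (q t) (x t)\<bar> \<le> c"
  shows "norm (jacobian \<Phi> (at (x t)) *v (f (x t) + pid_control ystar f h k (q t) (x t) *\<^sub>R g (x t)))
     \<le> real CARD('n) * c"
proof -
  let ?u = "pid_control ystar f h k (q t) (x t)"
  let ?z = "jacobian \<Phi> (at (x t)) *v (f (x t) + ?u *\<^sub>R g (x t))"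
  have z: "?z $ i = lie_iter f (Suc (pos i)) h (x t) + ?u * lie_deriv g (lie_iter f (pos i) h) (x t)" for i
  proof -
    have "linear (frechet_derivative (lie_iter f (pos i) h) (at (x t)))"
      by (rule has_derivative_linear[OF smooth_has_derivative[OF smooth_output]])
    then show ?thesis
      unfolding jacobian_Phi_nth lie_iter_Suc
      by (simp add: lie_deriv_eq_derivative[OF smooth_output] linear_add linear_cmul)
  qed
  have "\<bar>?z $ i\<bar> \<le> c" for i
  proof (cases "Suc (pos i) = CARD('n)")
    case True
    then have "CARD('n) - 1 = pos i" by simp
    then show ?thesis
      using last True unfolding z drift_def input_gain_def by (simp add: mult.commute)
  next
    case False
    then have "pos i + 2 \<le> CARD('n)" using pos_less_card[of i] by simp
    then show ?thesis
      using err[of "Suc (Suc (pos i))"] unfolding z by (simp add: lie_deriv_input_eq_0 chain_error_def)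
  qed
  then have "(\<Sum>i\<in>UNIV. \<bar>?z $ i\<bar>) \<le> (\<Sum>i\<in>(UNIV :: 'n set). c)" by (intro sum_mono)
  then show ?thesis using norm_le_l1_cart[of ?z] by simp
qed

text \<open>
  The velocity of \<open>x\<close> is the inverse Jacobian applied to the velocity of \<open>\<Phi>(x)\<close>, which decays
  exponentially, so the bound for logarithmically superlinear growth applies.
\<close>

lemma state_bound_of_jacobian_inverse_bound:
  assumes jac: "jacobian_inverse_bound f h" and C: "C \<ge> 0"
    and decay: "errors_decay ystar f g h k R qs C"
  shows "\<exists>M. \<forall>x q T. norm (x 0) \<le> R \<longrightarrow> q 0 = 0 \<longrightarrow> 0 \<le> T \<longrightarrow> solves_on ystar f g h k {0..T} x q \<longrightarrow>
     norm (x T) \<le> M"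
proof -
  obtain N1 N2 where N: "N1 > 0" "N2 > 0"
    "\<And>x. onorm ((*v) (matrix_inv (jacobian \<Phi> (at x)))) \<le> N1 * norm x * ln (norm x) + N2"
    using jac unfolding jacobian_inverse_bound_def by blast
  have "norm (x T) \<le> exp (exp (ln (ln (3 + R\<^sup>2)) + 2 * ((N1 + N2) * (real CARD('n) * C))))"
    if init: "norm (x 0) \<le> R" "q 0 = 0" and T: "0 \<le> T" and sol: "solves_on ystar f g h k {0..T} x q" for x q T
  proof (rule norm_bound_of_log_growth[where x' = "\<lambda>t. f (x t) + pid_control ystar f h k (q t) (x t) *\<^sub>R g (x t)"])
    fix t assume t: "t \<in> {0..T}"
    let ?v = "f (x t) + pid_control ystar f h k (q t) (x t) *\<^sub>R g (x t)"
    let ?J = "jacobian \<Phi> (at (x t))"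
    show "(x has_vector_derivative ?v) (at t within {0..T})" using sol t by (simp add: solves_on_def)
    have z: "norm (?J *v ?v) \<le> real CARD('n) * (C * exp (- t / 2))"
      using decay init sol t unfolding errors_decay_def by (intro norm_jacobian_velocity_le[OF sol t, where qs = qs]) auto
    have "?v = matrix_inv ?J *v (?J *v ?v)"
      by (simp add: matrix_vector_mul_assoc matrix_inv_left[OF invertible_jacobian_Phi])
    then have "norm ?v \<le> onorm ((*v) (matrix_inv ?J)) * norm (?J *v ?v)"
      using onorm[OF matrix_vector_mul_bounded_linear] by metis
    also have "\<dots> \<le> (N1 * norm (x t) * ln (norm (x t)) + N2) * (real CARD('n) * (C * exp (- t / 2)))"
      by (intro mult_mono N z norm_ge_zero order_trans[OF onorm_pos_le N(3)] matrix_vector_mul_bounded_linear)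
    finally show "norm ?v \<le> (N1 * norm (x t) * ln (norm (x t)) + N2) * (real CARD('n) * C * exp (- t / 2))"
      by (simp add: mult.assoc)
  qed (use N C init T in auto)
  then show ?thesis by blast
qed

lemma output_error_decay:
  assumes decay: "errors_decay ystar f g h k R qs C" and C: "C > 0"
    and init: "norm xi \<le> R" and sol: "closed_loop_solution ystar f g h k xi x q"
  shows "converges_to_zero_exponentially (\<lambda>t. ystar - h (x t))"
    and "\<And>t. t \<ge> 0 \<Longrightarrow> norm (\<Phi> (x t) - zstar ystar) \<le> real CARD('n) * (C * exp (- t / 2))"
proof -
  have err: "\<bar>chain_error ystar f h qs (q t) (x t) i\<bar> \<le> C * exp (- t / 2)"
    if "t \<ge> 0" "i \<le> CARD('n)" for t i
  proof -
    have "solves_on ystar f g h k {0..t} x q"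
      using sol by (auto simp: closed_loop_solution_iff intro: solves_on_subset)
    then show ?thesis
      using decay init sol that unfolding errors_decay_def closed_loop_solution_iff by force
  qed
  have "\<bar>ystar - h (x t)\<bar> \<le> C * exp (- (1/2) * t)" if "t \<ge> 0" for t
    using err[OF that, of 1] by (simp add: chain_error_def lie_iter_def abs_minus_commute Suc_le_eq)
  then show "converges_to_zero_exponentially (\<lambda>t. ystar - h (x t))"
    unfolding converges_to_zero_exponentially_def using C
    by (intro exI[of _ C] conjI exI[of _ "1/2"]) auto
  show "norm (\<Phi> (x t) - zstar ystar) \<le> real CARD('n) * (C * exp (- t / 2))" if "t \<ge> 0" for t
    using err[OF that] by (rule norm_Phi_minus_zstar_le)
qed

lemma closed_loop_solution_exists_of_state_bound:
  assumes decay: "errors_decay ystar f g h k R qs C" and C: "C > 0" and init: "norm xi \<le> R"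
    and state: "\<And>x q T. norm (x 0) \<le> R \<Longrightarrow> q 0 = 0 \<Longrightarrow> 0 \<le> T \<Longrightarrow>
      solves_on ystar f g h k {0..T} x q \<Longrightarrow> norm (x T) \<le> M"
  shows "\<exists>x q. closed_loop_solution ystar f g h k xi x q"
proof (rule closed_loop_solution_exists)
  fix x :: "real \<Rightarrow> 'n vect" and q :: "real \<Rightarrow> real" and T :: real
  assume *: "x 0 = xi" "q 0 = 0" "0 \<le> T" "solves_on ystar f g h k {0..T} x q"
  then have "\<bar>chain_error ystar f h qs (q T) (x T) 0\<bar> \<le> C * exp (- T / 2)"
    using decay init unfolding errors_decay_def by force
  also have "\<dots> \<le> C * 1" using C * by (intro mult_left_mono) auto
  finally have "\<bar>q T\<bar> \<le> \<bar>qs\<bar> + C" by (simp add: chain_error_def)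
  moreover have "norm (x T) \<le> M" using state[OF _ *(2,3,4)] * init by simp
  ultimately show "norm (x T) \<le> M \<and> \<bar>q T\<bar> \<le> \<bar>qs\<bar> + C" by blast
qed

lemma state_bound_of_diffeo:
  assumes inv: "bij \<Phi>" "continuous_on UNIV (inv \<Phi>)"
  shows "\<exists>M. \<forall>x. norm (\<Phi> x - zstar ystar) \<le> r \<longrightarrow> norm x \<le> M"
proof -
  have "compact (inv \<Phi> ` cball (zstar ystar) r)"
    using inv(2) by (intro compact_continuous_image) (auto intro: continuous_on_subset)
  then obtain M where M: "\<And>z. z \<in> cball (zstar ystar) r \<Longrightarrow> norm (inv \<Phi> z) \<le> M"
    using compact_imp_bounded bounded_iff by (metis imageI)
  have "norm x \<le> M" if "norm (\<Phi> x - zstar ystar) \<le> r" for x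
    using M[of "\<Phi> x"] that inv(1) by (simp add: dist_norm norm_minus_commute bij_is_inj)
  then show ?thesis by blast
qed

end

section \<open>Regulation by extended PID control\<close>

theorem theorem1:
  shows
  "(\<forall>ystar b \<tau>1 \<tau>2. admissible_data b \<tau>1 \<tau>2 \<longrightarrow>
     (\<forall>R>0. \<exists>\<Omega> :: (real \<times> ('n::{finite,linorder}) vect) set.
        open \<Omega> \<and> \<not> bounded \<Omega> \<and>
        (\<forall>f g :: 'n vect \<Rightarrow> 'n vect. \<forall>h :: 'n vect \<Rightarrow> real.
           smooth f \<and> smooth g \<and> smooth h \<and>
           uniform_relative_degree b f g h \<and>
           growth_bounds ystar \<tau>1 \<tau>2 f g h \<and>
           jacobian_inverse_bound f h \<longrightarrow>
           (\<forall>k\<in>\<Omega>. \<forall>xi. norm xi \<le> R \<longrightarrow>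
              (\<exists>x q. closed_loop_solution ystar f g h k xi x q) \<and>
              (\<forall>x q. closed_loop_solution ystar f g h k xi x q \<longrightarrow>
                 converges_to_zero_exponentially (\<lambda>t. ystar - h (x t)))))))
   \<and>
   (\<exists>\<xi> :: real \<Rightarrow> ('n vect \<Rightarrow> 'n vect) \<Rightarrow> 'n vect.
     \<forall>ystar b \<tau>1 \<tau>2. admissible_data b \<tau>1 \<tau>2 \<longrightarrow>
     (\<forall>R>0. \<exists>\<Omega> :: (real \<times> 'n vect) set.
        open \<Omega> \<and> \<not> bounded \<Omega> \<and>
        (\<forall>f g :: 'n vect \<Rightarrow> 'n vect. \<forall>h :: 'n vect \<Rightarrow> real.
           smooth f \<and> smooth g \<and> smooth h \<and>
           uniform_relative_degree b f g h \<and>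
           growth_bounds ystar \<tau>1 \<tau>2 f g h \<and>
           global_C1_diffeo (Phi f h) \<longrightarrow>
           (\<forall>k\<in>\<Omega>. \<forall>xi. norm xi \<le> R \<longrightarrow>
              (\<exists>x q. closed_loop_solution ystar f g h k xi x q) \<and>
              (\<forall>x q. closed_loop_solution ystar f g h k xi x q \<longrightarrow>
                 converges_to_zero_exponentially (\<lambda>t. ystar - h (x t)) \<and>
                 bounded (x ` {0..}) \<and>
                 (x \<longlongrightarrow> \<xi> ystar (Phi f h)) at_top)))))"
proof (rule conjI)
  show "\<forall>ystar b \<tau>1 \<tau>2. admissible_data b \<tau>1 \<tau>2 \<longrightarrow>
     (\<forall>R>0. \<exists>\<Omega> :: (real \<times> 'n vect) set.
        open \<Omega> \<and> \<not> bounded \<Omega> \<and>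
        (\<forall>f g :: 'n vect \<Rightarrow> 'n vect. \<forall>h :: 'n vect \<Rightarrow> real.
           smooth f \<and> smooth g \<and> smooth h \<and>
           uniform_relative_degree b f g h \<and>
           growth_bounds ystar \<tau>1 \<tau>2 f g h \<and>
           jacobian_inverse_bound f h \<longrightarrow>
           (\<forall>k\<in>\<Omega>. \<forall>xi. norm xi \<le> R \<longrightarrow>
              (\<exists>x q. closed_loop_solution ystar f g h k xi x q) \<and>
              (\<forall>x q. closed_loop_solution ystar f g h k xi x q \<longrightarrow>
                 converges_to_zero_exponentially (\<lambda>t. ystar - h (x t))))))"
  proof (intro allI impI)
    fix ystar b :: real and \<tau>1 \<tau>2 :: "real \<Rightarrow> real" and R :: real
    assume data: "admissible_data b \<tau>1 \<tau>2" "R > 0"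
    obtain \<Omega> :: "(real \<times> 'n vect) set"
      where \<Omega>: "open \<Omega>" "\<not> bounded \<Omega>"
        "\<forall>f g h. affine_system f g h b \<longrightarrow> growth_bounds ystar \<tau>1 \<tau>2 f g h \<longrightarrow>
           (\<forall>k\<in>\<Omega>. \<exists>qs C. C > 0 \<and> errors_decay ystar f g h k R qs C)"
      by (rule admissible_gains[OF data, where ystar = ystar])
    show "\<exists>\<Omega> :: (real \<times> 'n vect) set.
        open \<Omega> \<and> \<not> bounded \<Omega> \<and>
        (\<forall>f g :: 'n vect \<Rightarrow> 'n vect. \<forall>h :: 'n vect \<Rightarrow> real.
           smooth f \<and> smooth g \<and> smooth h \<and>
           uniform_relative_degree b f g h \<and>
           growth_bounds ystar \<tau>1 \<tau>2 f g h \<and>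
           jacobian_inverse_bound f h \<longrightarrow>
           (\<forall>k\<in>\<Omega>. \<forall>xi. norm xi \<le> R \<longrightarrow>
              (\<exists>x q. closed_loop_solution ystar f g h k xi x q) \<and>
              (\<forall>x q. closed_loop_solution ystar f g h k xi x q \<longrightarrow>
                 converges_to_zero_exponentially (\<lambda>t. ystar - h (x t)))))"
    proof (intro exI[of _ \<Omega>] conjI \<Omega>(1,2) allI impI ballI; elim conjE)
      fix f g :: "'n vect \<Rightarrow> 'n vect" and h :: "'n vect \<Rightarrow> real"
        and k :: "real \<times> 'n vect" and xi :: "'n vect"
      assume "smooth f" "smooth g" "smooth h" "uniform_relative_degree b f g h"
        and growth: "growth_bounds ystar \<tau>1 \<tau>2 f g h" and jac: "jacobian_inverse_bound f h"
        and k: "k \<in> \<Omega>" and xi: "norm xi \<le> R"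
      then interpret affine_system f g h b by unfold_locales
      obtain qs C where C: "C > 0" and decay: "errors_decay ystar f g h k R qs C"
        using \<Omega>(3) affine_system_axioms growth k by blast
      obtain M where M: "\<And>x q T. norm (x 0) \<le> R \<Longrightarrow> q 0 = 0 \<Longrightarrow> 0 \<le> T \<Longrightarrow>
          solves_on ystar f g h k {0..T} x q \<Longrightarrow> norm (x T) \<le> M"
        using state_bound_of_jacobian_inverse_bound[OF jac less_imp_le[OF C] decay] by metis
      show "\<exists>x q. closed_loop_solution ystar f g h k xi x q"
        by (rule closed_loop_solution_exists_of_state_bound[OF decay C xi]) (rule M)
      show "converges_to_zero_exponentially (\<lambda>t. ystar - h (x t))"
        if "closed_loop_solution ystar f g h k xi x q" for x q
        by (rule output_error_decay(1)[OF decay C xi that])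
    qed
  qed
next
  show "\<exists>\<xi> :: real \<Rightarrow> ('n vect \<Rightarrow> 'n vect) \<Rightarrow> 'n vect.
     \<forall>ystar b \<tau>1 \<tau>2. admissible_data b \<tau>1 \<tau>2 \<longrightarrow>
     (\<forall>R>0. \<exists>\<Omega> :: (real \<times> 'n vect) set.
        open \<Omega> \<and> \<not> bounded \<Omega> \<and>
        (\<forall>f g :: 'n vect \<Rightarrow> 'n vect. \<forall>h :: 'n vect \<Rightarrow> real.
           smooth f \<and> smooth g \<and> smooth h \<and>
           uniform_relative_degree b f g h \<and>
           growth_bounds ystar \<tau>1 \<tau>2 f g h \<and>
           global_C1_diffeo (Phi f h) \<longrightarrow>
           (\<forall>k\<in>\<Omega>. \<forall>xi. norm xi \<le> R \<longrightarrow>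
              (\<exists>x q. closed_loop_solution ystar f g h k xi x q) \<and>
              (\<forall>x q. closed_loop_solution ystar f g h k xi x q \<longrightarrow>
                 converges_to_zero_exponentially (\<lambda>t. ystar - h (x t)) \<and>
                 bounded (x ` {0..}) \<and>
                 (x \<longlongrightarrow> \<xi> ystar (Phi f h)) at_top))))"
  proof (intro exI[of _ "\<lambda>ystar \<Phi>. inv \<Phi> (zstar ystar)"] allI impI)
    fix ystar b :: real and \<tau>1 \<tau>2 :: "real \<Rightarrow> real" and R :: real
    assume data: "admissible_data b \<tau>1 \<tau>2" "R > 0"
    obtain \<Omega> :: "(real \<times> 'n vect) set"
      where \<Omega>: "open \<Omega>" "\<not> bounded \<Omega>"
        "\<forall>f g h. affine_system f g h b \<longrightarrow> growth_bounds ystar \<tau>1 \<tau>2 f g h \<longrightarrow>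
           (\<forall>k\<in>\<Omega>. \<exists>qs C. C > 0 \<and> errors_decay ystar f g h k R qs C)"
      by (rule admissible_gains[OF data, where ystar = ystar])
    show "\<exists>\<Omega> :: (real \<times> 'n vect) set.
        open \<Omega> \<and> \<not> bounded \<Omega> \<and>
        (\<forall>f g :: 'n vect \<Rightarrow> 'n vect. \<forall>h :: 'n vect \<Rightarrow> real.
           smooth f \<and> smooth g \<and> smooth h \<and>
           uniform_relative_degree b f g h \<and>
           growth_bounds ystar \<tau>1 \<tau>2 f g h \<and>
           global_C1_diffeo (Phi f h) \<longrightarrow>
           (\<forall>k\<in>\<Omega>. \<forall>xi. norm xi \<le> R \<longrightarrow>
              (\<exists>x q. closed_loop_solution ystar f g h k xi x q) \<and>
              (\<forall>x q. closed_loop_solution ystar f g h k xi x q \<longrightarrow>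
                 converges_to_zero_exponentially (\<lambda>t. ystar - h (x t)) \<and>
                 bounded (x ` {0..}) \<and>
                 (x \<longlongrightarrow> inv (Phi f h) (zstar ystar)) at_top)))"
    proof (rule exI[of _ \<Omega>], intro conjI \<Omega>(1,2) allI impI ballI; elim conjE)
      fix f g :: "'n vect \<Rightarrow> 'n vect" and h :: "'n vect \<Rightarrow> real"
        and k :: "real \<times> 'n vect" and xi :: "'n vect"
      assume "smooth f" "smooth g" "smooth h" "uniform_relative_degree b f g h"
        and growth: "growth_bounds ystar \<tau>1 \<tau>2 f g h" and diffeo: "global_C1_diffeo (Phi f h)"
        and k: "k \<in> \<Omega>" and xi: "norm xi \<le> R"
      then interpret affine_system f g h b by unfold_locales
      obtain qs C where C: "C > 0" and decay: "errors_decay ystar f g h k R qs C"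
        using \<Omega>(3) affine_system_axioms growth k by blast
      have bij: "bij \<Phi>" using diffeo by (simp add: global_C1_diffeo_def)
      have cont: "continuous_on UNIV (inv \<Phi>)"
        using diffeo Ck_Suc_imp_Ck[of 0 "inv \<Phi>"] by (simp add: global_C1_diffeo_def)
      obtain M where M: "\<And>x. norm (\<Phi> x - zstar ystar) \<le> real CARD('n) * C \<Longrightarrow> norm x \<le> M"
        using state_bound_of_diffeo[OF bij cont] by blast
      have le: "real CARD('n) * (C * exp (- t / 2)) \<le> real CARD('n) * C" if "t \<ge> 0" for t
        using that C by simp
      show "\<exists>x q. closed_loop_solution ystar f g h k xi x q"
      proof (rule closed_loop_solution_exists_of_state_bound[OF decay C xi])
        fix x q T
        assume "norm (x 0) \<le> R" "q 0 = 0" "0 \<le> T" "solves_on ystar f g h k {0..T} x q"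
        then have "\<bar>chain_error ystar f h qs (q T) (x T) i\<bar> \<le> C * exp (- T / 2)" if "i \<le> CARD('n)" for i
          using decay that unfolding errors_decay_def by force
        then have "norm (\<Phi> (x T) - zstar ystar) \<le> real CARD('n) * (C * exp (- T / 2))"
          by (rule norm_Phi_minus_zstar_le)
        with le[OF \<open>0 \<le> T\<close>] show "norm (x T) \<le> M" by (intro M) linarith
      qed
      fix x q
      assume sol: "closed_loop_solution ystar f g h k xi x q"
      note near = output_error_decay(2)[OF decay C xi sol]
      show "converges_to_zero_exponentially (\<lambda>t. ystar - h (x t))"
        by (rule output_error_decay(1)[OF decay C xi sol])
      have "norm (x t) \<le> M" if "t \<ge> 0" for t
        using near[OF that] le[OF that] by (intro M) linarith
      then show "bounded (x ` {0..})" by (auto simp: bounded_iff)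
      have "((\<lambda>t. real CARD('n) * (C * exp (- t / 2))) \<longlongrightarrow> 0) at_top"
      proof -
        have "filterlim (\<lambda>t :: real. (1 / 2) * t) at_top at_top"
          by (rule filterlim_tendsto_pos_mult_at_top[OF tendsto_const]) (auto intro: filterlim_ident)
        then have "filterlim (\<lambda>t :: real. - t / 2) at_bot at_top"
          by (simp add: filterlim_uminus_at_bot)
        from filterlim_compose[OF exp_at_bot this] show ?thesis
          by (intro tendsto_mult_right_zero)
      qed
      moreover have "\<forall>\<^sub>F t in at_top. norm (\<Phi> (x t) - zstar ystar) \<le> real CARD('n) * (C * exp (- t / 2))"
        by (rule eventually_at_top_linorderI[of 0]) (rule near)
      ultimately have "((\<lambda>t. \<Phi> (x t) - zstar ystar) \<longlongrightarrow> 0) at_top"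
        by (rule Lim_null_comparison[rotated])
      then have "((\<lambda>t. \<Phi> (x t)) \<longlongrightarrow> zstar ystar) at_top" by (rule LIM_zero_cancel)
      moreover have "isCont (inv \<Phi>) (zstar ystar)"
        using cont by (simp add: continuous_on_eq_continuous_at)
      ultimately have "((\<lambda>t. inv \<Phi> (\<Phi> (x t))) \<longlongrightarrow> inv \<Phi> (zstar ystar)) at_top"
        by (rule isCont_tendsto_compose[rotated])
      then show "(x \<longlongrightarrow> inv \<Phi> (zstar ystar)) at_top"
        using bij by (simp add: bij_is_inj)
    qed
  qed
qed

end
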